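(* A point transformation $\Phi$ connects two equations $\bar{\mathcal K}_{A,B}$ and $\bar{\mathcal K}_{\tilde A,\tilde B}$ from the class $\bar{\mathcal K}$ of Kolmogorov equations if and only if its components are of the form \[ \tilde t=T(t),\quad\tilde x=X(t,x),\quad\tilde u=U^1(t,x)u+U^0(t,x), \] where $T$ and $X$ are arbitrary smooth functions of their arguments with $T_tX_x\ne0$, $U^1\neq0$, and $1/U^1$ and $U^0/U^1$ run through the solution set of the equation $\bar{\mathcal K}_{A,B}$. The arbitrary elements of the source and the target equations are related by \[ \Phi^*\tilde A=\frac{X_x^2}{T_t}A,\qquad \Phi^*\tilde B=\frac{X_x}{T_t}\left(B-2\frac{U^1_x}{U^1}A\right)-\frac{X_t-X_{xx}A}{T_t}. \]
   Context: Everything is real, smooth and local; $f\neq0$ for a function means that it vanishes nowhere on its domain. The class $\bar{\mathcal K}$ consists of the equations $\bar{\mathcal K}_{A,B}$: $u_t=A(t,x)u_{xx}+B(t,x)u_x$, where $A$ and $B$ are arbitrary smooth functions of $(t,x)$ with $A\neq0$. A point transformation is a local diffeomorphism of the space with coordinates $(t,x,u)$; it connects (maps) the source equation $\bar{\mathcal K}_{A,B}$ to the target equation $\bar{\mathcal K}_{\tilde A,\tilde B}$ if the pushforward of the former by it is the latter. $\Phi^*\tilde A$ denotes $\tilde A(T(t),X(t,x))$, and similarly for $\tilde B$. *)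

theory Defs
  imports "HOL-Analysis.Analysis"
begin

text \<open>
  \<open>smooth_on S f\<close> means \<open>C\<^sup>\<infinity>\<close> and is only ever used with \<open>S\<close> open: \<open>f\<close> is of class \<open>C\<^sup>(\<^sup>k\<^sup>+\<^sup>1\<^sup>)\<close>
  if it is differentiable and all its directional derivatives are of class \<open>C\<^sup>k\<close>.
\<close>

primrec Ck_on ::
  "nat \<Rightarrow> 'a::real_normed_vector set \<Rightarrow> ('a \<Rightarrow> 'b::real_normed_vector) \<Rightarrow> bool"
where
  "Ck_on 0 S f \<longleftrightarrow> continuous_on S f"
| "Ck_on (Suc k) S f \<longleftrightarrow>
     (\<forall>p\<in>S. f differentiable (at p)) \<and> (\<forall>v. Ck_on k S (\<lambda>p. frechet_derivative f (at p) v))"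

definition smooth_on ::
  "'a::real_normed_vector set \<Rightarrow> ('a \<Rightarrow> 'b::real_normed_vector) \<Rightarrow> bool" where
  "smooth_on S f \<longleftrightarrow> (\<forall>k. Ck_on k S f)"

definition pd_t :: "(real \<times> real \<Rightarrow> real) \<Rightarrow> real \<times> real \<Rightarrow> real" where
  "pd_t f = (\<lambda>(t, x). deriv (\<lambda>s. f (s, x)) t)"

definition pd_x :: "(real \<times> real \<Rightarrow> real) \<Rightarrow> real \<times> real \<Rightarrow> real" where
  "pd_x f = (\<lambda>(t, x). deriv (\<lambda>y. f (t, y)) x)"

text \<open>
  Points of the second-order jet space with coordinates
  \<open>(t, x, u, u\<^sub>t, u\<^sub>x, u\<^sub>t\<^sub>t, u\<^sub>t\<^sub>x, u\<^sub>x\<^sub>x)\<close>.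
\<close>

type_synonym jet =
  "real \<times> real \<times> real \<times> real \<times> real \<times> real \<times> real \<times> real"

definition jet2 :: "(real \<times> real \<Rightarrow> real) \<Rightarrow> real \<times> real \<Rightarrow> jet" where
  "jet2 f p =
     (fst p, snd p, f p, pd_t f p, pd_x f p, pd_t (pd_t f) p, pd_t (pd_x f) p, pd_x (pd_x f) p)"

definition kolmogorov_class ::
  "(real \<times> real) set \<Rightarrow> (real \<times> real \<Rightarrow> real) \<Rightarrow> (real \<times> real \<Rightarrow> real) \<Rightarrow> bool" where
  "kolmogorov_class D A B \<longleftrightarrow>
     open D \<and> smooth_on D A \<and> smooth_on D B \<and> (\<forall>p\<in>D. A p \<noteq> 0)"

text \<open>The equation \<open>u\<^sub>t = A u\<^sub>x\<^sub>x + B u\<^sub>x\<close> over \<open>D\<close>, as a subset of the jet space.\<close>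

definition kolmogorov_eq ::
  "(real \<times> real) set \<Rightarrow> (real \<times> real \<Rightarrow> real) \<Rightarrow> (real \<times> real \<Rightarrow> real) \<Rightarrow> jet set" where
  "kolmogorov_eq D A B =
     {(t, x, u, ut, ux, utt, utx, uxx). (t, x) \<in> D \<and> ut = A (t, x) * uxx + B (t, x) * ux}"

definition kolmogorov_solution ::
  "(real \<times> real) set \<Rightarrow> (real \<times> real \<Rightarrow> real) \<Rightarrow> (real \<times> real \<Rightarrow> real) \<Rightarrow>
     (real \<times> real \<Rightarrow> real) \<Rightarrow> bool" where
  "kolmogorov_solution D A B f \<longleftrightarrow> smooth_on D f \<and> jet2 f ` D \<subseteq> kolmogorov_eq D A B"

text \<open>
  A local diffeomorphism of the \<open>(t, x, u)\<close>-space is understood, as usual for point transformations,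
  as a diffeomorphism of an open subset onto an open subset.
\<close>

definition point_transformation ::
  "(real \<times> real \<times> real) set \<Rightarrow> (real \<times> real \<times> real \<Rightarrow> real \<times> real \<times> real) \<Rightarrow> bool" where
  "point_transformation \<Omega> \<Phi> \<longleftrightarrow>
     open \<Omega> \<and> smooth_on \<Omega> \<Phi> \<and> open (\<Phi> ` \<Omega>) \<and>
     (\<exists>\<Psi>. smooth_on (\<Phi> ` \<Omega>) \<Psi> \<and> (\<forall>p\<in>\<Omega>. \<Psi> (\<Phi> p) = p))"

definition lift_pt :: "(real \<times> real \<Rightarrow> real) \<Rightarrow> real \<times> real \<Rightarrow> real \<times> real \<times> real" where
  "lift_pt f p = (fst p, snd p, f p)"

text \<open>
  The second prolongation of \<open>\<Phi>\<close>, as the graph of a partial map of the jet space: if \<open>\<Phi>\<close> maps the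
  graph of a function \<open>f\<close> onto the graph of a function \<open>g\<close>, then it maps the jets of \<open>f\<close> to
  the jets of \<open>g\<close> at the corresponding points. It is partial because the image of the graph of a
  function need not be the graph of a function, however small the domain of \<open>f\<close> is.
\<close>

definition prolongation ::
  "(real \<times> real \<times> real) set \<Rightarrow> (real \<times> real \<times> real \<Rightarrow> real \<times> real \<times> real) \<Rightarrow> (jet \<times> jet) set" where
  "prolongation \<Omega> \<Phi> =
     {(jet2 f p, jet2 g q) | f g V W p q.
        open V \<and> open W \<and> smooth_on V f \<and> smooth_on W g \<and>
        lift_pt f ` V \<subseteq> \<Omega> \<and> \<Phi> ` lift_pt f ` V = lift_pt g ` W \<and>
        p \<in> V \<and> q \<in> W \<and> \<Phi> (lift_pt f p) = lift_pt g q}"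

text \<open>
  The pushforward of the equation \<open>E\<close> is the equation \<open>E'\<close>. The latter has to be restricted to the
  jets on which the prolongation of the inverse of \<open>\<Phi>\<close> is defined; over each point of
  \<open>\<Phi> ` \<Omega>\<close>, these are all the jets apart from those whose \<open>(u\<^sub>t, u\<^sub>x)\<close> lies on a certain line
  (or all the jets, if \<open>\<Phi>\<close> maps the \<open>u\<close>-direction to the \<open>u\<close>-direction there).
\<close>

definition connects ::
  "(real \<times> real \<times> real) set \<Rightarrow> (real \<times> real \<times> real \<Rightarrow> real \<times> real \<times> real) \<Rightarrow>
     jet set \<Rightarrow> jet set \<Rightarrow> bool" where
  "connects \<Omega> \<Phi> E E' \<longleftrightarrow> prolongation \<Omega> \<Phi> `` E = E' \<inter> Range (prolongation \<Omega> \<Phi>)"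

definition over :: "(real \<times> real) set \<Rightarrow> (real \<times> real \<times> real) set" where
  "over D = {(t, x, u). (t, x) \<in> D}"

definition open_interval :: "real set \<Rightarrow> bool" where
  "open_interval I \<longleftrightarrow> I \<noteq> {} \<and> open I \<and> is_interval I"

definition affine_map ::
  "(real \<Rightarrow> real) \<Rightarrow> (real \<times> real \<Rightarrow> real) \<Rightarrow> (real \<times> real \<Rightarrow> real) \<Rightarrow> (real \<times> real \<Rightarrow> real) \<Rightarrow>
     real \<times> real \<times> real \<Rightarrow> real \<times> real \<times> real" where
  "affine_map T X U1 U0 =
     (\<lambda>(t, x, u). (T t, X (t, x), U1 (t, x) * u + U0 (t, x)))"

definition admissible_params ::
  "(real \<times> real \<Rightarrow> real) \<Rightarrow> (real \<times> real \<Rightarrow> real) \<Rightarrow> real set \<Rightarrow> real set \<Rightarrow>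
     (real \<Rightarrow> real) \<Rightarrow> (real \<times> real \<Rightarrow> real) \<Rightarrow> (real \<times> real \<Rightarrow> real) \<Rightarrow> (real \<times> real \<Rightarrow> real) \<Rightarrow> bool"
where
  "admissible_params A B I J T X U1 U0 \<longleftrightarrow>
     smooth_on I T \<and> smooth_on (I \<times> J) X \<and> smooth_on (I \<times> J) U1 \<and> smooth_on (I \<times> J) U0 \<and>
     (\<forall>t\<in>I. \<forall>x\<in>J. deriv T t * pd_x X (t, x) \<noteq> 0 \<and> U1 (t, x) \<noteq> 0) \<and>
     kolmogorov_solution (I \<times> J) A B (\<lambda>p. 1 / U1 p) \<and>
     kolmogorov_solution (I \<times> J) A B (\<lambda>p. U0 p / U1 p)"

end

theory Submission
  imports Defs
begin

text \<open>
  Necessity is shown by pushing forward the graphs of quadratic polynomials whose jets lie on the source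
  equation. Through each point there are such polynomials with arbitrary \<open>u\<^sub>x\<close>, \<open>u\<^sub>x\<^sub>x\<close> and \<open>u\<^sub>t\<^sub>t\<close>, and
  the inverse function theorem makes the image of the graph a graph again wherever the total Jacobian
  of \<open>(T, X)\<close> does not vanish. Since the target equation contains no \<open>u\<^sub>t\<^sub>t\<close> and \<open>u\<^sub>t\<^sub>x\<close>, varying \<open>u\<^sub>t\<^sub>t\<close>
  forces \<open>T\<^sub>x = T\<^sub>u = 0\<close>; varying \<open>u\<^sub>x\<^sub>x\<close> gives \<open>A' T\<^sub>t = A (X\<^sub>x + X\<^sub>u u\<^sub>x)\<^sup>2\<close>, whence \<open>X\<^sub>u = 0\<close>; and the
  coefficient of \<open>u\<^sub>x\<^sup>2\<close> gives \<open>U\<^sub>u\<^sub>u = 0\<close>. Comparing the remaining coefficients yields the formulas for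
  \<open>A'\<close>, \<open>B'\<close> and linear equations for \<open>U\<^sup>1\<close>, \<open>U\<^sup>0\<close>, which the substitution \<open>f = v / U\<^sup>1\<close> turns into
  the source equation for \<open>1 / U\<^sup>1\<close> and \<open>U\<^sup>0 / U\<^sup>1\<close>. The same comparison read backwards is sufficiency.
\<close>


section \<open>Calculus of smooth functions\<close>

text \<open>Two obstacles shape necessity. The prolongation is partial, so only jets with nonzero
  total Jacobian can be tested. That Jacobian is affine in (\<open>ux\<close>, \<open>ut\<close>),
  and its coefficients are, up to sign, the 2x2 minors of the derivative of (T, X). These do not all
  vanish because the derivative of \<open>\<Phi>\<close> is onto, so usable jets with two different
  \<open>ux\<close> always remain. Moreover, while T may still depend on x and u, the full second
  prolongation mixes in g_tt and g_tx, on which the target equation says nothing. Differentiating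
  only along curves on the graph whose initial direction annihilates T leaves g_xx as the sole
  second derivative. The image jet thus enters through three numbers, which are eliminated by
  comparing jets that differ in one coordinate. Statements such as T_x = 0 integrate only along
  connected slices, hence the boxes \<open>I \<times> J \<times> K\<close>. In the converse
  direction the interval factors pay off again: nonzero derivatives make the map injective on the
  entire box, so nothing has to be shrunk.\<close>

lemma Ck_on_cong:
  assumes "open S" "\<And>p. p \<in> S \<Longrightarrow> f p = g p" "Ck_on k S f"
  shows "Ck_on k S g"
  using assms(2,3)
proof (induction k arbitrary: f g)
  case 0
  then show ?case
    by (auto intro: continuous_on_eq)
next
  case (Suc k)
  have "g differentiable at p \<and> frechet_derivative f (at p) = frechet_derivative g (at p)"
    if p: "p \<in> S" for p
  proof -
    have f: "f differentiable at p"
      using Suc.prems p by simp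
    then have "(g has_derivative frechet_derivative f (at p)) (at p)"
      unfolding frechet_derivative_works
      by (rule has_derivative_transform_within_open[OF _ assms(1) p Suc.prems(1)])
    with frechet_derivative_transform_within_open[OF f assms(1) p Suc.prems(1)] show ?thesis
      by (auto simp: differentiable_def)
  qed
  moreover have "Ck_on k S (\<lambda>p. frechet_derivative g (at p) v)" for v
    using Suc.IH[of "\<lambda>p. frechet_derivative f (at p) v"] Suc.prems(2) calculation by simp
  ultimately show ?case
    by simp
qed

text \<open>Lets the inductions below use whatever derivative a differentiation rule delivers;
  uniqueness of derivatives identifies it with \<open>frechet_derivative\<close> on the open
  set.\<close>

lemma Ck_on_derivI:
  assumes "open S" "\<And>p. p \<in> S \<Longrightarrow> (f has_derivative f' p) (at p)"
    and "\<And>v. Ck_on k S (\<lambda>p. f' p v)"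
  shows "Ck_on (Suc k) S f"
proof -
  have "f' p = frechet_derivative f (at p)" if "p \<in> S" for p
    using assms(2)[OF that] by (rule frechet_derivative_at)
  then have "Ck_on k S (\<lambda>p. frechet_derivative f (at p) v)" for v
    by (intro Ck_on_cong[OF assms(1) _ assms(3)[of v]]) simp
  then show ?thesis
    using assms(2) by (auto simp: differentiable_def)
qed

lemma Ck_on_has_derivative:
  "Ck_on (Suc k) S f \<Longrightarrow> p \<in> S \<Longrightarrow> (f has_derivative frechet_derivative f (at p)) (at p)"
  by (simp add: frechet_derivative_works)

lemma Ck_on_SucD: "Ck_on (Suc k) S f \<Longrightarrow> Ck_on k S f"
proof (induction k arbitrary: f)
  case 0
  then show ?case
    by (auto intro!: differentiable_imp_continuous_on differentiable_at_imp_differentiable_on)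
qed auto

lemma Ck_on_subset: "Ck_on k S f \<Longrightarrow> T \<subseteq> S \<Longrightarrow> Ck_on k T f"
proof (induction k arbitrary: f)
  case 0
  then show ?case
    using continuous_on_subset by auto
qed auto

lemma Ck_on_const: "open S \<Longrightarrow> Ck_on k S (\<lambda>p. c)"
proof (induction k arbitrary: c)
  case (Suc k)
  then show ?case
    by (intro Ck_on_derivI[where f' = "\<lambda>p v. 0"]) auto
qed auto

lemma Ck_on_linear: "open S \<Longrightarrow> bounded_linear L \<Longrightarrow> Ck_on k S L"
  by (cases k)
    (auto intro!: Ck_on_derivI[where f' = "\<lambda>p. L"] Ck_on_const bounded_linear_imp_has_derivative
      linear_continuous_on simp del: Ck_on.simps(2))

lemma Ck_on_add:
  assumes "open S" "Ck_on k S f" "Ck_on k S g"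
  shows "Ck_on k S (\<lambda>p. f p + g p)"
  using assms(2,3)
proof (induction k arbitrary: f g)
  case (Suc k)
  show ?case
    by (rule Ck_on_derivI[OF assms(1) has_derivative_add[OF Suc.prems[THEN Ck_on_has_derivative]]])
      (use Suc in auto)
qed (auto intro: continuous_on_add)

text \<open>The product rule is again a sum of values of \<open>B\<close>, so the induction closes.
  Real products and scalar multiples are both instances.\<close>

lemma Ck_on_bilinear:
  assumes "bounded_bilinear B" "open S" "Ck_on k S f" "Ck_on k S g"
  shows "Ck_on k S (\<lambda>p. B (f p) (g p))"
  using assms(3,4)
proof (induction k arbitrary: f g)
  case 0
  then show ?case
    using assms(1) by (auto intro: bounded_bilinear.continuous_on)
next
  case (Suc k)
  show ?case
  proof (rule Ck_on_derivI[OF assms(2)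
        bounded_bilinear.FDERIV[OF assms(1) Suc.prems[THEN Ck_on_has_derivative]]])
    show "Ck_on k S (\<lambda>p. B (f p) (frechet_derivative g (at p) v)
        + B (frechet_derivative f (at p) v) (g p))" for v
      using Suc.prems[THEN Ck_on_SucD] Suc.prems by (intro Ck_on_add assms(2) Suc.IH) auto
  qed auto
qed

lemma Ck_on_bounded_linear:
  assumes "bounded_linear L" "open S" "Ck_on k S f"
  shows "Ck_on k S (\<lambda>p. L (f p))"
  using assms(3)
proof (induction k arbitrary: f)
  case 0
  then show ?case
    using assms(1) by (auto intro: bounded_linear.continuous_on)
next
  case (Suc k)
  show ?case
    by (rule Ck_on_derivI[OF assms(2)
          bounded_linear.has_derivative[OF assms(1) Suc.prems[THEN Ck_on_has_derivative]]])
      (use Suc in auto)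
qed

lemma Ck_on_Pair:
  assumes "open S" "Ck_on k S f" "Ck_on k S g"
  shows "Ck_on k S (\<lambda>p. (f p, g p))"
  using assms(2,3)
proof (induction k arbitrary: f g)
  case (Suc k)
  show ?case
    by (rule Ck_on_derivI[OF assms(1) has_derivative_Pair[OF Suc.prems[THEN Ck_on_has_derivative]]])
      (use Suc in auto)
qed (auto intro: continuous_on_Pair)

lemma Ck_on_sum:
  assumes "open S" "\<And>i. i \<in> I \<Longrightarrow> Ck_on k S (f i)"
  shows "Ck_on k S (\<lambda>p. \<Sum>i\<in>I. f i p)"
  using assms(2)
  by (induction I rule: infinite_finite_induct) (auto intro: Ck_on_add Ck_on_const assms(1))

text \<open>\<open>Ck_on\<close> controls derivatives in fixed directions, whereas the chain rule
  evaluates the derivative of \<open>f\<close> in a direction that moves with \<open>p\<close>.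
  Expanding this direction in the finite basis gives a sum of scalar coefficients times derivatives
  of \<open>f\<close> in fixed directions; hence the Euclidean type of the middle space.\<close>

lemma Ck_on_compose:
  fixes g :: "'a::real_normed_vector \<Rightarrow> 'b::euclidean_space"
  assumes "open S" "open T" "g ` S \<subseteq> T" "Ck_on k T f" "Ck_on k S g"
  shows "Ck_on k S (\<lambda>p. f (g p))"
  using assms(4,5)
proof (induction k arbitrary: f)
  case 0
  then show ?case
    using assms(3) by (auto intro: continuous_on_compose2)
next
  case (Suc k)
  let ?g' = "\<lambda>p. frechet_derivative g (at p)" and ?f' = "\<lambda>q. frechet_derivative f (at q)"
  show ?case
  proof (rule Ck_on_derivI[OF assms(1), where f' = "\<lambda>p v. \<Sum>b\<in>Basis. (?g' p v \<bullet> b) *\<^sub>R ?f' (g p) b"])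
    fix p assume p: "p \<in> S"
    have f': "(f has_derivative ?f' (g p)) (at (g p))"
      using p assms(3) by (intro Ck_on_has_derivative[OF Suc.prems(1)]) auto
    interpret linear "?f' (g p)"
      using f' by (rule has_derivative_linear)
    have "?f' (g p) (?g' p v) = (\<Sum>b\<in>Basis. (?g' p v \<bullet> b) *\<^sub>R ?f' (g p) b)" for v
      by (subst euclidean_representation[of "?g' p v", symmetric]) (simp only: sum scale)
    then show "((\<lambda>p. f (g p)) has_derivative
        (\<lambda>v. \<Sum>b\<in>Basis. (?g' p v \<bullet> b) *\<^sub>R ?f' (g p) b)) (at p)"
      using has_derivative_compose[OF Ck_on_has_derivative[OF Suc.prems(2) p] f'] by simp
  next
    have "Ck_on k S (\<lambda>p. ?f' (g p) b)" for b
      using Suc.prems(1) Ck_on_SucD[OF Suc.prems(2)] by (intro Suc.IH) auto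
    then show "Ck_on k S (\<lambda>p. \<Sum>b\<in>Basis. (?g' p v \<bullet> b) *\<^sub>R ?f' (g p) b)" for v
      using Suc.prems(2)
      by (intro Ck_on_sum assms(1) Ck_on_bilinear[OF bounded_bilinear_scaleR]
          Ck_on_bounded_linear[OF bounded_linear_inner_left]) auto
  qed
qed

lemma Ck_on_inverse:
  fixes f :: "'a::real_normed_vector \<Rightarrow> real"
  assumes "open S" "\<And>p. p \<in> S \<Longrightarrow> f p \<noteq> 0" "Ck_on k S f"
  shows "Ck_on k S (\<lambda>p. inverse (f p))"
  using assms(3)
proof (induction k)
  case 0
  then show ?case
    using assms(2) by (auto intro: continuous_on_inverse)
next
  case (Suc k)
  show ?case
  proof (rule Ck_on_derivI[OF assms(1)
        Deriv.has_derivative_inverse[OF assms(2) Ck_on_has_derivative[OF Suc.prems]]])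
    \<comment> \<open>The derivative of the inverse contains the inverse again, but only its class
      \<open>k\<close> is required, which the induction hypothesis supplies. The factor
      \<open>- 1\<close> makes the negation a product.\<close>
    have "Ck_on k S (\<lambda>p. (- 1) * (inverse (f p) * frechet_derivative f (at p) v * inverse (f p)))" for v
      using Suc Ck_on_SucD[OF Suc.prems] by (intro Ck_on_bilinear[OF bounded_bilinear_mult] Ck_on_const assms(1) Suc.IH) auto
    then show "Ck_on k S (\<lambda>p. - (inverse (f p) * frechet_derivative f (at p) v * inverse (f p)))" for v
      by simp
  qed auto
qed

lemma smooth_on_cong:
  "open S \<Longrightarrow> (\<And>p. p \<in> S \<Longrightarrow> f p = g p) \<Longrightarrow> smooth_on S f \<Longrightarrow> smooth_on S g"
  unfolding smooth_on_def using Ck_on_cong by blast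

lemma smooth_on_subset: "smooth_on S f \<Longrightarrow> T \<subseteq> S \<Longrightarrow> smooth_on T f"
  unfolding smooth_on_def using Ck_on_subset by blast

lemma smooth_on_const: "open S \<Longrightarrow> smooth_on S (\<lambda>p. c)"
  by (simp add: smooth_on_def Ck_on_const)

lemma smooth_on_linear: "open S \<Longrightarrow> bounded_linear L \<Longrightarrow> smooth_on S L"
  by (simp add: smooth_on_def Ck_on_linear)

lemma smooth_on_bounded_linear:
  "bounded_linear L \<Longrightarrow> open S \<Longrightarrow> smooth_on S f \<Longrightarrow> smooth_on S (\<lambda>p. L (f p))"
  by (simp add: smooth_on_def Ck_on_bounded_linear)

lemma smooth_on_add:
  "open S \<Longrightarrow> smooth_on S f \<Longrightarrow> smooth_on S g \<Longrightarrow> smooth_on S (\<lambda>p. f p + g p)"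
  by (simp add: smooth_on_def Ck_on_add)

lemma smooth_on_mult:
  fixes f g :: "_ \<Rightarrow> real"
  shows "open S \<Longrightarrow> smooth_on S f \<Longrightarrow> smooth_on S g \<Longrightarrow> smooth_on S (\<lambda>p. f p * g p)"
  by (simp add: smooth_on_def Ck_on_bilinear[OF bounded_bilinear_mult])

lemma smooth_on_diff:
  fixes f g :: "_ \<Rightarrow> real"
  assumes "open S" "smooth_on S f" "smooth_on S g"
  shows "smooth_on S (\<lambda>p. f p - g p)"
  using smooth_on_add[OF assms(1,2) smooth_on_mult[OF assms(1) smooth_on_const[of S "-1"] assms(3)]]
    assms(1) by simp

lemma smooth_on_divide:
  fixes f g :: "_ \<Rightarrow> real"
  assumes "open S" "smooth_on S f" "smooth_on S g" "\<And>p. p \<in> S \<Longrightarrow> g p \<noteq> 0"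
  shows "smooth_on S (\<lambda>p. f p / g p)"
  unfolding divide_inverse using assms
  by (intro smooth_on_mult) (auto simp: smooth_on_def intro: Ck_on_inverse)

lemma smooth_on_Pair:
  "open S \<Longrightarrow> smooth_on S f \<Longrightarrow> smooth_on S g \<Longrightarrow> smooth_on S (\<lambda>p. (f p, g p))"
  by (simp add: smooth_on_def Ck_on_Pair)

lemma smooth_on_compose:
  fixes g :: "'a::real_normed_vector \<Rightarrow> 'b::euclidean_space"
  shows "open S \<Longrightarrow> open T \<Longrightarrow> g ` S \<subseteq> T \<Longrightarrow> smooth_on T f \<Longrightarrow> smooth_on S g \<Longrightarrow>
    smooth_on S (\<lambda>p. f (g p))"
  unfolding smooth_on_def using Ck_on_compose by blast

lemma smooth_on_frechet_derivative:
  assumes "smooth_on S f"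
  shows "smooth_on S (\<lambda>p. frechet_derivative f (at p) v)"
  unfolding smooth_on_def
proof
  show "Ck_on k S (\<lambda>p. frechet_derivative f (at p) v)" for k
    using assms[unfolded smooth_on_def, rule_format, of "Suc k"] by simp
qed

lemma smooth_on_has_derivative:
  "smooth_on S f \<Longrightarrow> p \<in> S \<Longrightarrow> (f has_derivative frechet_derivative f (at p)) (at p)"
  by (rule Ck_on_has_derivative[of 0]) (simp_all only: smooth_on_def)

lemma smooth_on_imp_continuous_on: "smooth_on S f \<Longrightarrow> continuous_on S f"
  by (auto simp: smooth_on_def dest: spec[of _ 0])

lemmas smooth_on_intros =
  smooth_on_const smooth_on_add smooth_on_mult smooth_on_diff smooth_on_divide smooth_on_Pair
  smooth_on_bounded_linear[OF bounded_linear_fst] smooth_on_bounded_linear[OF bounded_linear_snd]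
  smooth_on_linear[OF _ bounded_linear_fst] smooth_on_linear[OF _ bounded_linear_snd]
  smooth_on_linear[OF _ bounded_linear_ident]

subsection \<open>Partial derivatives of functions of two variables\<close>

lemma
  assumes "smooth_on S f" "open S"
  shows pd_t_eq_frechet: "p \<in> S \<Longrightarrow> pd_t f p = frechet_derivative f (at p) (1, 0)"
    and pd_x_eq_frechet: "p \<in> S \<Longrightarrow> pd_x f p = frechet_derivative f (at p) (0, 1)"
proof -
  assume p: "p \<in> S"
  obtain t x where tx: "p = (t, x)" by (cases p)
  have f': "(f has_derivative frechet_derivative f (at (t, x))) (at (t, x))"
    using smooth_on_has_derivative[OF assms(1) p] tx by simp
  interpret bounded_linear "frechet_derivative f (at (t, x))"
    using f' by (rule has_derivative_bounded_linear)
  have "((\<lambda>s. (s, x)) has_derivative (\<lambda>h. (h, 0))) (at t)"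
    by (auto intro!: derivative_eq_intros)
  from has_derivative_compose[OF this f']
  have "((\<lambda>s. f (s, x)) has_derivative (\<lambda>h. frechet_derivative f (at (t, x)) (h, 0))) (at t)" .
  moreover have "(\<lambda>h. frechet_derivative f (at (t, x)) (h, 0)) = (*) (frechet_derivative f (at (t, x)) (1, 0))"
  proof
    show "frechet_derivative f (at (t, x)) (h, 0) = frechet_derivative f (at (t, x)) (1, 0) * h" for h
      using scaleR[of h "(1, 0)"] by (simp only: scaleR_Pair real_scaleR_def mult_zero_right mult_1_right mult.commute[of h])
  qed
  ultimately have "((\<lambda>s. f (s, x)) has_real_derivative frechet_derivative f (at (t, x)) (1, 0)) (at t)"
    by (simp only: has_field_derivative_def)
  then show "pd_t f p = frechet_derivative f (at p) (1, 0)"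
    using tx by (simp add: pd_t_def DERIV_imp_deriv)
  have "((\<lambda>y. (t, y)) has_derivative (\<lambda>h. (0, h))) (at x)"
    by (auto intro!: derivative_eq_intros)
  from has_derivative_compose[OF this f']
  have "((\<lambda>y. f (t, y)) has_derivative (\<lambda>h. frechet_derivative f (at (t, x)) (0, h))) (at x)" .
  moreover have "(\<lambda>h. frechet_derivative f (at (t, x)) (0, h)) = (*) (frechet_derivative f (at (t, x)) (0, 1))"
  proof
    show "frechet_derivative f (at (t, x)) (0, h) = frechet_derivative f (at (t, x)) (0, 1) * h" for h
      using scaleR[of h "(0, 1)"] by (simp only: scaleR_Pair real_scaleR_def mult_zero_right mult_1_right mult.commute[of h])
  qed
  ultimately have "((\<lambda>y. f (t, y)) has_real_derivative frechet_derivative f (at (t, x)) (0, 1)) (at x)"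
    by (simp only: has_field_derivative_def)
  then show "pd_x f p = frechet_derivative f (at p) (0, 1)"
    using tx by (simp add: pd_x_def DERIV_imp_deriv)
qed

lemma
  assumes "smooth_on S f" "open S"
  shows smooth_on_pd_t: "smooth_on S (pd_t f)" and smooth_on_pd_x: "smooth_on S (pd_x f)"
  using pd_t_eq_frechet[OF assms] pd_x_eq_frechet[OF assms]
  by (auto intro!: smooth_on_cong[OF assms(2) _ smooth_on_frechet_derivative[OF assms(1)]])

lemma has_derivative_pd:
  assumes "smooth_on S f" "open S" "p \<in> S"
  shows "(f has_derivative (\<lambda>v. fst v * pd_t f p + snd v * pd_x f p)) (at p)"
proof -
  note f' = smooth_on_has_derivative[OF assms(1,3)]
  interpret bounded_linear "frechet_derivative f (at p)"
    using f' by (rule has_derivative_bounded_linear)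
  have "frechet_derivative f (at p) v = fst v * pd_t f p + snd v * pd_x f p" for v
    using add[of "fst v *\<^sub>R (1, 0)" "snd v *\<^sub>R (0, 1)"]
    by (simp only: scaleR pd_t_eq_frechet[OF assms] pd_x_eq_frechet[OF assms]) simp
  then have "frechet_derivative f (at p) = (\<lambda>v. fst v * pd_t f p + snd v * pd_x f p)"
    by auto
  with f' show ?thesis by simp
qed

lemma DERIV_pd_compose:
  assumes "smooth_on S f" "open S" "(a s, b s) \<in> S"
    and "(a has_real_derivative a') (at s)" "(b has_real_derivative b') (at s)"
  shows "((\<lambda>s. f (a s, b s)) has_real_derivative pd_t f (a s, b s) * a' + pd_x f (a s, b s) * b') (at s)"
proof -
  have "((\<lambda>s. (a s, b s)) has_derivative (\<lambda>h. (a' * h, b' * h))) (at s)"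
    using assms(4,5) by (intro has_derivative_Pair) (auto simp: has_field_derivative_def)
  from has_derivative_compose[OF this has_derivative_pd[OF assms(1-3)]]
  show ?thesis
    by (simp add: has_field_derivative_def) (auto simp: algebra_simps elim!: has_derivative_eq_rhs)
qed

lemma
  assumes "smooth_on S f" "open S" "(t, x) \<in> S"
  shows DERIV_pd_t: "((\<lambda>s. f (s, x)) has_real_derivative pd_t f (t, x)) (at t)"
    and DERIV_pd_x: "((\<lambda>y. f (t, y)) has_real_derivative pd_x f (t, x)) (at x)"
  using DERIV_pd_compose[OF assms(1,2), of "\<lambda>s. s" t "\<lambda>s. x" 1 0]
    DERIV_pd_compose[OF assms(1,2), of "\<lambda>s. t" x "\<lambda>s. s" 0 1] assms(3) by auto

section \<open>Inverse functions in the plane\<close>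

definition jac :: "(real \<times> real \<Rightarrow> real) \<Rightarrow> (real \<times> real \<Rightarrow> real) \<Rightarrow> real \<times> real \<Rightarrow> real" where
  "jac a b p = pd_t a p * pd_x b p - pd_x a p * pd_t b p"

lemma smooth_on_jac:
  "open S \<Longrightarrow> smooth_on S a \<Longrightarrow> smooth_on S b \<Longrightarrow> smooth_on S (jac a b)"
  unfolding jac_def by (intro smooth_on_intros smooth_on_pd_t smooth_on_pd_x)

text \<open>Bootstrapping: the derivative of the inverse is a smooth function composed with the
  inverse itself, so class n of the inverse yields class n + 1. Openness of the image is invariance
  of domain.\<close>

lemma smooth_inverse_plane:
  fixes a b :: "real \<times> real \<Rightarrow> real" and S :: "(real \<times> real) set"
  defines "h \<equiv> \<lambda>p. (a p, b p)"
  assumes S: "open S" and a: "smooth_on S a" and b: "smooth_on S b"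
    and inj: "inj_on h S" and jac: "\<And>p. p \<in> S \<Longrightarrow> jac a b p \<noteq> 0"
  shows "open (h ` S)" and "smooth_on (h ` S) (inv_into S h)"
proof -
  let ?k = "inv_into S h"
  \<comment> \<open>Cramer's rule: the inverse of the Jacobian matrix of \<open>(a, b)\<close> at
    \<open>p\<close>, applied to \<open>w\<close>.\<close>
  define m where "m w p = ((pd_x b p * fst w - pd_x a p * snd w) / jac a b p,
    (pd_t a p * snd w - pd_t b p * fst w) / jac a b p)" for w p
  have h: "(h has_derivative
      (\<lambda>v. (fst v * pd_t a p + snd v * pd_x a p, fst v * pd_t b p + snd v * pd_x b p))) (at p)"
    if "p \<in> S" for p
    unfolding h_def using has_derivative_pd[OF a S that] has_derivative_pd[OF b S that]
    by (rule has_derivative_Pair)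
  have cont: "continuous_on S h"
    unfolding h_def using a b by (intro continuous_on_Pair smooth_on_imp_continuous_on)
  show op: "open (h ` S)"
    using cont S inj by (rule invariance_of_domain)
  have k': "(?k has_derivative (\<lambda>w. m w (?k q))) (at q)" if q: "q \<in> h ` S" for q
  proof -
    obtain p where p: "p \<in> S" "q = h p"
      using q by auto
    have "(?k has_derivative (\<lambda>w. m w p)) (at (h p))"
    proof (rule has_derivative_inverse_strong[OF S p(1) cont _ h[OF p(1)]])
      show "?k (h x) = x" if "x \<in> S" for x
        using inj that by simp
      show "(\<lambda>v. (fst v * pd_t a p + snd v * pd_x a p, fst v * pd_t b p + snd v * pd_x b p))
          \<circ> (\<lambda>w. m w p) = id"
        using jac[OF p(1)] by (auto simp: m_def field_simps fun_eq_iff) (auto simp: jac_def algebra_simps)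
    qed
    then show ?thesis
      using p inj by simp
  qed
  have m: "smooth_on S (m w)" for w
    unfolding m_def using S a b jac
    by (intro smooth_on_intros smooth_on_pd_t smooth_on_pd_x smooth_on_jac) auto
  have "Ck_on n (h ` S) ?k" for n
  proof (induction n)
    case 0
    show ?case
      unfolding Ck_on.simps
      by (intro continuous_at_imp_continuous_on ballI has_derivative_continuous[OF k'])
  next
    case (Suc n)
    show ?case
    proof (rule Ck_on_derivI[OF op k'])
      show "Ck_on n (h ` S) (\<lambda>q. m w (?k q))" for w
        by (rule Ck_on_compose[OF op S _ _ Suc]) (use m[of w] in \<open>auto simp: smooth_on_def inv_into_into\<close>)
    qed
  qed
  then show "smooth_on (h ` S) ?k"
    by (simp add: smooth_on_def)
qed

text \<open>Continuity of the four entries of the Jacobian matrix gives continuity of the derivative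
  in operator norm at \<open>p\<close>, as the local injectivity theorem demands. The ball is then
  cut down to the open set where the determinant does not vanish.\<close>

lemma locally_injective_plane:
  fixes a b :: "real \<times> real \<Rightarrow> real" and S :: "(real \<times> real) set"
  assumes S: "open S" and a: "smooth_on S a" and b: "smooth_on S b"
    and p: "p \<in> S" and jac: "jac a b p \<noteq> 0"
  obtains V where "open V" "p \<in> V" "V \<subseteq> S" "inj_on (\<lambda>p. (a p, b p)) V"
    "\<And>p. p \<in> V \<Longrightarrow> jac a b p \<noteq> 0"
proof -
  define h' where "h' x v = (fst v * pd_t a x + snd v * pd_x a x, fst v * pd_t b x + snd v * pd_x b x)"
    for x v :: "real \<times> real"
  define g' where "g' w = ((pd_x b p * fst w - pd_x a p * snd w) / jac a b p,
    (pd_t a p * snd w - pd_t b p * fst w) / jac a b p)" for w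
  \<comment> \<open>A linear map is its own derivative, so its boundedness can be read off from the
    derivative calculus.\<close>
  have "((\<lambda>w. (pd_x b p * fst w - pd_x a p * snd w) / jac a b p) has_derivative
      (\<lambda>w. (pd_x b p * fst w - pd_x a p * snd w) / jac a b p)) (at 0)"
    "((\<lambda>w. (pd_t a p * snd w - pd_t b p * fst w) / jac a b p) has_derivative
      (\<lambda>w. (pd_t a p * snd w - pd_t b p * fst w) / jac a b p)) (at 0)"
    using jac by (auto intro!: derivative_eq_intros simp: field_simps)
  then have bl: "bounded_linear g'"
    unfolding g'_def by (intro bounded_linear_Pair) (auto dest: has_derivative_bounded_linear)
  have id: "g' \<circ> h' p = id"
    using jac by (auto simp: g'_def h'_def field_simps fun_eq_iff) (auto simp: jac_def algebra_simps)
  have der: "((\<lambda>p. (a p, b p)) has_derivative h' x) (at x)" if "x \<in> S" for x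
    unfolding h'_def using has_derivative_pd[OF a S that] has_derivative_pd[OF b S that]
    by (rule has_derivative_Pair)
  have small: "\<exists>d>0. \<forall>x. dist p x < d \<longrightarrow> onorm (\<lambda>v. h' x v - h' p v) < e" if "e > 0" for e
  proof -
    \<comment> \<open>\<open>N\<close> bounds the operator norm of the change of the derivative
      between \<open>p\<close> and \<open>x\<close>, and it vanishes at \<open>p\<close>.\<close>
    define N where "N x = \<bar>pd_t a x - pd_t a p\<bar> + \<bar>pd_x a x - pd_x a p\<bar> + \<bar>pd_t b x - pd_t b p\<bar> + \<bar>pd_x b x - pd_x b p\<bar>"
      for x
    have "continuous_on S N"
      unfolding N_def using a b S
      by (intro continuous_intros smooth_on_imp_continuous_on smooth_on_pd_t smooth_on_pd_x)
    then have "isCont N p"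
      using S p by (simp add: continuous_on_eq_continuous_at)
    then obtain d where d: "d > 0" "\<And>x. dist x p < d \<Longrightarrow> dist (N x) (N p) < e"
      using \<open>e > 0\<close> unfolding continuous_at_eps_delta by (auto simp: dist_commute)
    have le: "onorm (\<lambda>v. h' x v - h' p v) \<le> N x" for x
    proof (rule onorm_le)
      fix v :: "real \<times> real"
      have v: "\<bar>fst v\<bar> \<le> norm v" "\<bar>snd v\<bar> \<le> norm v"
        using norm_fst_le[of "fst v" "snd v"] norm_snd_le[of "snd v" "fst v"] by auto
      have "h' x v - h' p v = (fst v * (pd_t a x - pd_t a p) + snd v * (pd_x a x - pd_x a p),
          fst v * (pd_t b x - pd_t b p) + snd v * (pd_x b x - pd_x b p))"
        by (simp add: h'_def algebra_simps)
      then have "norm (h' x v - h' p v) \<le>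
          \<bar>fst v * (pd_t a x - pd_t a p) + snd v * (pd_x a x - pd_x a p)\<bar> +
          \<bar>fst v * (pd_t b x - pd_t b p) + snd v * (pd_x b x - pd_x b p)\<bar>"
        using norm_Pair_le[of "fst v * (pd_t a x - pd_t a p) + snd v * (pd_x a x - pd_x a p)"
            "fst v * (pd_t b x - pd_t b p) + snd v * (pd_x b x - pd_x b p)"] by simp
      also have "\<dots> \<le> \<bar>fst v\<bar> * \<bar>pd_t a x - pd_t a p\<bar> + \<bar>snd v\<bar> * \<bar>pd_x a x - pd_x a p\<bar>
          + (\<bar>fst v\<bar> * \<bar>pd_t b x - pd_t b p\<bar> + \<bar>snd v\<bar> * \<bar>pd_x b x - pd_x b p\<bar>)"
        unfolding abs_mult[symmetric] by (intro add_mono abs_triangle_ineq)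
      also have "\<dots> \<le> norm v * \<bar>pd_t a x - pd_t a p\<bar> + norm v * \<bar>pd_x a x - pd_x a p\<bar>
          + (norm v * \<bar>pd_t b x - pd_t b p\<bar> + norm v * \<bar>pd_x b x - pd_x b p\<bar>)"
        using v by (intro add_mono mult_right_mono) auto
      also have "\<dots> = N x * norm v"
        by (simp add: N_def algebra_simps)
      finally show "norm (h' x v - h' p v) \<le> N x * norm v" .
    qed
    have less: "N x < e" if "dist p x < d" for x
      using d(2)[of x] that by (simp add: N_def dist_real_def dist_commute)
    show ?thesis
      by (intro exI[of _ d] conjI d(1) allI impI le_less_trans[OF le less])
  qed
  obtain r where r: "r > 0" "ball p r \<subseteq> S" "inj_on (\<lambda>p. (a p, b p)) (ball p r)"
    by (rule has_derivative_locally_injective[OF p S bl id der small])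
  define V where "V = ball p r \<inter> jac a b -` (- {0})"
  show ?thesis
  proof (rule that)
    have "continuous_on (ball p r) (jac a b)"
      using smooth_on_imp_continuous_on[OF smooth_on_jac[OF S a b]] r(2) by (rule continuous_on_subset)
    then show "open V"
      unfolding V_def by (rule continuous_open_preimage) auto
    show "p \<in> V" "V \<subseteq> S"
      using r jac by (auto simp: V_def)
    show "inj_on (\<lambda>p. (a p, b p)) V"
      using r(3) by (rule inj_on_subset) (simp add: V_def)
    show "jac a b x \<noteq> 0" if "x \<in> V" for x
      using that by (simp add: V_def)
  qed
qed

section \<open>Graphs of functions under point transformations\<close>

lemma DERIV_unique_on_open:
  fixes f g :: "real \<Rightarrow> real"
  assumes "(f has_real_derivative a) (at s)" "(g has_real_derivative b) (at s)"
    and "open Z" "s \<in> Z" "\<And>z. z \<in> Z \<Longrightarrow> f z = g z"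
  shows "a = b"
  using has_field_derivative_transform_within_open[OF assms(1,3,4,5)] assms(2) by (rule DERIV_unique)

lemma smooth_on_lift_pt: "open S \<Longrightarrow> smooth_on S f \<Longrightarrow> smooth_on S (lift_pt f)"
  unfolding lift_pt_def by (intro smooth_on_intros)

lemma
  assumes "\<Phi> ` lift_pt f ` V = lift_pt g ` W" "p \<in> V" "\<Phi> (lift_pt f p) = (t', x', u')"
  shows graph_image_in_domain: "(t', x') \<in> W" and graph_image_value: "g (t', x') = u'"
proof -
  have "(t', x', u') \<in> lift_pt g ` W"
    unfolding assms(1,3)[symmetric] using assms(2) by (intro imageI)
  then show "(t', x') \<in> W" "g (t', x') = u'"
    by (auto simp: lift_pt_def)
qed

text \<open>The nonzero Jacobian makes the base map from (t, x) to (T, X) along the graph of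
  \<open>f\<close> locally invertible; \<open>g\<close> is the u-component of the moved graph
  composed with the inverse of the base map.\<close>

lemma graph_image_exists:
  assumes pt: "point_transformation \<Omega> \<Phi>" and f: "smooth_on UNIV f" and p: "lift_pt f p \<in> \<Omega>"
    and jac: "jac (\<lambda>p. fst (\<Phi> (lift_pt f p))) (\<lambda>p. fst (snd (\<Phi> (lift_pt f p)))) p \<noteq> 0"
  obtains V W g where "open V" "p \<in> V" "open W" "smooth_on V f" "smooth_on W g"
    "lift_pt f ` V \<subseteq> \<Omega>" "\<Phi> ` lift_pt f ` V = lift_pt g ` W"
proof -
  let ?a = "\<lambda>p. fst (\<Phi> (lift_pt f p))" and ?b = "\<lambda>p. fst (snd (\<Phi> (lift_pt f p)))"
  let ?h = "\<lambda>p. (?a p, ?b p)"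
  define N where "N = lift_pt f -` \<Omega>"
  have \<Omega>: "open \<Omega>" "smooth_on \<Omega> \<Phi>"
    using pt by (auto simp: point_transformation_def)
  have lift: "smooth_on UNIV (lift_pt f)"
    using f by (simp add: smooth_on_lift_pt)
  have N: "open N"
    unfolding N_def using lift \<Omega>
    by (intro open_vimage) (auto dest: smooth_on_imp_continuous_on)
  have \<Phi>N: "smooth_on N (\<lambda>p. \<Phi> (lift_pt f p))"
    by (rule smooth_on_compose[OF N \<Omega>(1) _ \<Omega>(2) smooth_on_subset[OF lift]]) (auto simp: N_def)
  have ab: "smooth_on N ?a" "smooth_on N ?b"
    using \<Phi>N N by (auto intro!: smooth_on_intros)
  have "p \<in> N"
    using p by (simp add: N_def)
  from locally_injective_plane[OF N ab this jac] obtain V where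
    V: "open V" "p \<in> V" "V \<subseteq> N" "inj_on ?h V" "\<And>p. p \<in> V \<Longrightarrow> jac ?a ?b p \<noteq> 0"
    by blast
  let ?k = "inv_into V ?h"
  note inv = smooth_inverse_plane[OF V(1) ab[THEN smooth_on_subset[OF _ V(3)]] V(4,5)]
  define g where "g q = snd (snd (\<Phi> (lift_pt f (?k q))))" for q
  have "smooth_on (?h ` V) (\<lambda>q. \<Phi> (lift_pt f (?k q)))"
    by (rule smooth_on_compose[OF inv(1) V(1) _ smooth_on_subset[OF \<Phi>N V(3)] inv(2)])
      (auto simp: inv_into_f_f[OF V(4)])
  then have g: "smooth_on (?h ` V) g"
    unfolding g_def using inv(1) by (intro smooth_on_intros)
  have "lift_pt g (?h p) = \<Phi> (lift_pt f p)" if "p \<in> V" for p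
    using V(4) that by (auto simp: lift_pt_def[of g] g_def inv_into_f_f[OF V(4)])
  then have "\<Phi> ` lift_pt f ` V = lift_pt g ` ?h ` V"
    unfolding image_image by (intro image_cong) auto
  with that[OF V(1,2) inv(1) smooth_on_subset[OF f] g] V(3) show ?thesis
    by (auto simp: N_def)
qed

lemma open_slices:
  fixes N :: "(real \<times> real) set"
  assumes "open N"
  shows "open {s. (s, x) \<in> N}" "open {y. (t, y) \<in> N}"
proof -
  have "open ((\<lambda>s. (s, x)) -` N)" "open ((\<lambda>y. (t, y)) -` N)"
    using assms by (auto intro!: open_vimage continuous_intros)
  then show "open {s. (s, x) \<in> N}" "open {y. (t, y) \<in> N}"
    by (auto simp: vimage_def)
qed

lemma smooth_on_DERIV:
  fixes T :: "real \<Rightarrow> real"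
  assumes "smooth_on I T" "t \<in> I"
  shows "(T has_real_derivative deriv T t) (at t)"
  using smooth_on_has_derivative[OF assms]
  by (auto simp: DERIV_deriv_iff_real_differentiable differentiable_def)

text \<open>The identities result from differentiating
  \<open>g (T t, X (t, x)) = U1 (t, x) * f (t, x) + U0 (t, x)\<close>. Since T does not depend on x,
  two differentiations in x produce no mixed derivative of \<open>g\<close>. Both directions of the
  theorem rest on these formulas.\<close>

lemma affine_prolongation:
  assumes I: "open I" "smooth_on I T" and S: "open S" "smooth_on S X" "smooth_on S U1" "smooth_on S U0"
    and f: "open V" "smooth_on V f" and g: "open W" "smooth_on W g"
    and nbhd: "open N" "(t, x) \<in> N" "N \<subseteq> S" "N \<subseteq> V"
    and graph: "\<forall>p\<in>N. fst p \<in> I \<and> (T (fst p), X p) \<in> W \<and> g (T (fst p), X p) = U1 p * f p + U0 p"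
  defines "q \<equiv> (T t, X (t, x))"
  shows "pd_t g q * deriv T t + pd_x g q * pd_t X (t, x) =
      pd_t U1 (t, x) * f (t, x) + U1 (t, x) * pd_t f (t, x) + pd_t U0 (t, x)"
    and "pd_x g q * pd_x X (t, x) =
      pd_x U1 (t, x) * f (t, x) + U1 (t, x) * pd_x f (t, x) + pd_x U0 (t, x)"
    and "pd_x (pd_x g) q * (pd_x X (t, x))\<^sup>2 + pd_x g q * pd_x (pd_x X) (t, x) =
      pd_x (pd_x U1) (t, x) * f (t, x) + 2 * pd_x U1 (t, x) * pd_x f (t, x)
      + U1 (t, x) * pd_x (pd_x f) (t, x) + pd_x (pd_x U0) (t, x)"
proof -
  have "s \<in> I \<and> (T s, X (s, y)) \<in> W \<and> g (T s, X (s, y)) = U1 (s, y) * f (s, y) + U0 (s, y)"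
    if "(s, y) \<in> N" for s y
    using bspec[OF graph that] by simp
  then have N: "open N" "(t, x) \<in> N" "N \<subseteq> S" "N \<subseteq> V" "\<And>s y. (s, y) \<in> N \<Longrightarrow> s \<in> I"
    "\<And>s y. (s, y) \<in> N \<Longrightarrow> (T s, X (s, y)) \<in> W"
    "\<And>s y. (s, y) \<in> N \<Longrightarrow> g (T s, X (s, y)) = U1 (s, y) * f (s, y) + U0 (s, y)"
    using nbhd by blast+
  note DX = DERIV_pd_t[OF S(2,1) N(3)[THEN subsetD]] DERIV_pd_x[OF S(2,1) N(3)[THEN subsetD]]
  show "pd_t g q * deriv T t + pd_x g q * pd_t X (t, x) =
      pd_t U1 (t, x) * f (t, x) + U1 (t, x) * pd_t f (t, x) + pd_t U0 (t, x)"
  proof (rule DERIV_unique_on_open[OF _ _ open_slices(1)[OF N(1), of x]])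
    show "((\<lambda>s. g (T s, X (s, x))) has_real_derivative
        pd_t g q * deriv T t + pd_x g q * pd_t X (t, x)) (at t)"
      unfolding q_def
      by (rule DERIV_pd_compose[OF g(2,1) N(6)[OF N(2)] smooth_on_DERIV[OF I(2) N(5)[OF N(2)]] DX(1)[OF N(2)]])
    show "((\<lambda>s. U1 (s, x) * f (s, x) + U0 (s, x)) has_real_derivative
        pd_t U1 (t, x) * f (t, x) + U1 (t, x) * pd_t f (t, x) + pd_t U0 (t, x)) (at t)"
      using DERIV_add[OF DERIV_mult[OF DERIV_pd_t[OF S(3,1) N(3)[THEN subsetD, OF N(2)]]
          DERIV_pd_t[OF f(2,1) N(4)[THEN subsetD, OF N(2)]]] DERIV_pd_t[OF S(4,1) N(3)[THEN subsetD, OF N(2)]]]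
      by (simp add: mult.commute add.commute)
  qed (use N in auto)
  \<comment> \<open>Stated at all nearby y, because this identity is differentiated once
    more.\<close>
  have x: "pd_x g (T t, X (t, y)) * pd_x X (t, y) =
      pd_x U1 (t, y) * f (t, y) + U1 (t, y) * pd_x f (t, y) + pd_x U0 (t, y)" if y: "(t, y) \<in> N" for y
  proof (rule DERIV_unique_on_open[OF _ _ open_slices(2)[OF N(1), of t]])
    from DERIV_pd_compose[OF g(2,1) N(6)[OF y] DERIV_const DX(2)[OF y]]
    show "((\<lambda>y. g (T t, X (t, y))) has_real_derivative
        pd_x g (T t, X (t, y)) * pd_x X (t, y)) (at y)" by simp
    show "((\<lambda>y. U1 (t, y) * f (t, y) + U0 (t, y)) has_real_derivative
        pd_x U1 (t, y) * f (t, y) + U1 (t, y) * pd_x f (t, y) + pd_x U0 (t, y)) (at y)"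
      using DERIV_add[OF DERIV_mult[OF DERIV_pd_x[OF S(3,1) N(3)[THEN subsetD, OF y]]
          DERIV_pd_x[OF f(2,1) N(4)[THEN subsetD, OF y]]] DERIV_pd_x[OF S(4,1) N(3)[THEN subsetD, OF y]]]
      by (simp add: mult.commute add.commute)
  qed (use y N in auto)
  from x[OF N(2)] show "pd_x g q * pd_x X (t, x) =
      pd_x U1 (t, x) * f (t, x) + U1 (t, x) * pd_x f (t, x) + pd_x U0 (t, x)"
    by (simp add: q_def)
  show "pd_x (pd_x g) q * (pd_x X (t, x))\<^sup>2 + pd_x g q * pd_x (pd_x X) (t, x) =
      pd_x (pd_x U1) (t, x) * f (t, x) + 2 * pd_x U1 (t, x) * pd_x f (t, x)
      + U1 (t, x) * pd_x (pd_x f) (t, x) + pd_x (pd_x U0) (t, x)"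
  proof (rule DERIV_unique_on_open[OF _ _ open_slices(2)[OF N(1), of t]])
    note xS = N(3)[THEN subsetD, OF N(2)] and xV = N(4)[THEN subsetD, OF N(2)]
    from DERIV_mult[OF DERIV_pd_compose[OF smooth_on_pd_x[OF g(2,1)] g(1) N(6)[OF N(2)]
          DERIV_const DX(2)[OF N(2)]] DERIV_pd_x[OF smooth_on_pd_x[OF S(2,1)] S(1) xS]]
    show "((\<lambda>y. pd_x g (T t, X (t, y)) * pd_x X (t, y)) has_real_derivative
        pd_x (pd_x g) q * (pd_x X (t, x))\<^sup>2 + pd_x g q * pd_x (pd_x X) (t, x)) (at x)"
      by (simp add: q_def power2_eq_square ac_simps)
    from DERIV_add[OF DERIV_add[OF DERIV_mult[OF DERIV_pd_x[OF smooth_on_pd_x[OF S(3,1)] S(1) xS]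
          DERIV_pd_x[OF f(2,1) xV]] DERIV_mult[OF DERIV_pd_x[OF S(3,1) xS]
            DERIV_pd_x[OF smooth_on_pd_x[OF f(2,1)] f(1) xV]]] DERIV_pd_x[OF smooth_on_pd_x[OF S(4,1)] S(1) xS]]
    show "((\<lambda>y. pd_x U1 (t, y) * f (t, y) + U1 (t, y) * pd_x f (t, y) + pd_x U0 (t, y)) has_real_derivative
      pd_x (pd_x U1) (t, x) * f (t, x) + 2 * pd_x U1 (t, x) * pd_x f (t, x)
      + U1 (t, x) * pd_x (pd_x f) (t, x) + pd_x (pd_x U0) (t, x)) (at x)"
      by (rule DERIV_cong) simp
  qed (use N x in auto)
qed

subsection \<open>Directional derivatives in the space of the variables t, x, u\<close>

text \<open>The total derivatives along a graph with slopes \<open>ut\<close>, \<open>ux\<close> are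
  \<open>dd (1, 0, ut)\<close> and \<open>dd (0, 1, ux)\<close>.\<close>

definition dd ::
  "real \<times> real \<times> real \<Rightarrow> (real \<times> real \<times> real \<Rightarrow> real) \<Rightarrow> real \<times> real \<times> real \<Rightarrow> real" where
  "dd v F P = frechet_derivative F (at P) v"

lemma smooth_on_dd: "smooth_on \<Omega> F \<Longrightarrow> smooth_on \<Omega> (dd v F)"
  unfolding dd_def by (rule smooth_on_frechet_derivative)

lemma has_derivative_dd: "smooth_on \<Omega> F \<Longrightarrow> P \<in> \<Omega> \<Longrightarrow> (F has_derivative (\<lambda>v. dd v F P)) (at P)"
  unfolding dd_def by (rule smooth_on_has_derivative)

lemma dd_unique: "(F has_derivative F') (at P) \<Longrightarrow> dd v F P = F' v"
  unfolding dd_def by (drule frechet_derivative_at) simp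

lemma dd_coords:
  assumes "smooth_on \<Omega> F" "P \<in> \<Omega>"
  shows "dd (a, b, c) F P = a * dd (1, 0, 0) F P + b * dd (0, 1, 0) F P + c * dd (0, 0, 1) F P"
proof -
  interpret bounded_linear "\<lambda>v. dd v F P"
    using has_derivative_dd[OF assms] by (rule has_derivative_bounded_linear)
  have "(a, b, c) = a *\<^sub>R (1, 0, 0) + (b *\<^sub>R (0, 1, 0) + c *\<^sub>R (0, 0, 1 :: real))"
    by simp
  then show ?thesis
    by (simp only: add scaleR) simp
qed

lemma dd_scale_add:
  assumes "smooth_on \<Omega> F" "P \<in> \<Omega>"
  shows "dd (v + r *\<^sub>R w) F P = dd v F P + r * dd w F P"
proof -
  interpret bounded_linear "\<lambda>v. dd v F P"
    using has_derivative_dd[OF assms] by (rule has_derivative_bounded_linear)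
  show ?thesis
    by (simp only: add scaleR) simp
qed

lemma DERIV_dd:
  assumes "smooth_on \<Omega> F" "(\<alpha> s, \<beta> s, \<gamma> s) \<in> \<Omega>"
    and "(\<alpha> has_real_derivative a) (at s)" "(\<beta> has_real_derivative b) (at s)"
      "(\<gamma> has_real_derivative c) (at s)"
  shows "((\<lambda>s. F (\<alpha> s, \<beta> s, \<gamma> s)) has_real_derivative dd (a, b, c) F (\<alpha> s, \<beta> s, \<gamma> s)) (at s)"
proof -
  have "((\<lambda>s. (\<alpha> s, \<beta> s, \<gamma> s)) has_derivative (\<lambda>h. (a * h, b * h, c * h))) (at s)"
    using assms(3-5) by (intro has_derivative_Pair) (auto simp: has_field_derivative_def)
  note has_derivative_compose[OF this has_derivative_dd[OF assms(1,2)]]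
  moreover have "(\<lambda>h. dd (a * h, b * h, c * h) F (\<alpha> s, \<beta> s, \<gamma> s))
      = (*) (dd (a, b, c) F (\<alpha> s, \<beta> s, \<gamma> s))"
  proof
    fix h
    show "dd (a * h, b * h, c * h) F (\<alpha> s, \<beta> s, \<gamma> s) = dd (a, b, c) F (\<alpha> s, \<beta> s, \<gamma> s) * h"
      unfolding dd_coords[OF assms(1,2), of "a * h"] dd_coords[OF assms(1,2), of a]
      by (simp add: algebra_simps)
  qed
  ultimately show ?thesis
    by (simp only: has_field_derivative_def)
qed

text \<open>For \<open>v = (0, 1, 0)\<close>, \<open>w = (0, 0, 1)\<close>, \<open>r = ux\<close>
  this is the expansion in powers of \<open>ux\<close> of the part of the second total x-derivative
  that is free of \<open>uxx\<close>.\<close>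

lemma dd_dd_scale_add:
  assumes "smooth_on \<Omega> F" "open \<Omega>" "P \<in> \<Omega>"
  shows "dd (v + r *\<^sub>R w) (dd (v + r *\<^sub>R w) F) P =
    dd v (dd v F) P + r * (dd v (dd w F) P + dd w (dd v F) P) + r\<^sup>2 * dd w (dd w F) P"
proof -
  note F' = smooth_on_dd[OF assms(1)]
  have "((\<lambda>Q. dd v F Q + r * dd w F Q) has_derivative
      (\<lambda>z. dd z (dd v F) P + r * dd z (dd w F) P)) (at P)"
    by (intro has_derivative_add has_derivative_mult_right has_derivative_dd[OF F' assms(3)])
  then have "(dd (v + r *\<^sub>R w) F has_derivative
      (\<lambda>z. dd z (dd v F) P + r * dd z (dd w F) P)) (at P)"
    by (rule has_derivative_transform_within_open[OF _ assms(2,3)]) (simp only: dd_scale_add[OF assms(1)])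
  then show ?thesis
    by (simp only: dd_unique dd_scale_add[OF F' assms(3)]) (simp add: algebra_simps power2_eq_square)
qed

text \<open>
  The curve \<open>c\<close> lies on the graph of a function with image \<open>g\<close>. For directions \<open>v\<close> that are mapped
  into a plane of constant \<open>t\<close>, the only second derivative of \<open>g\<close> entering to second order is
  \<open>g\<^sub>x\<^sub>x\<close>.
\<close>

lemma curve_prolongation:
  fixes t x u \<alpha> \<beta> \<eta> \<omega> :: real and T X U :: "real \<times> real \<times> real \<Rightarrow> real"
  defines "c \<equiv> \<lambda>s. (t + s * \<alpha>, x + s * \<beta>, u + s * \<eta> + s\<^sup>2 * \<omega> / 2)"
    and "v \<equiv> (\<alpha>, \<beta>, \<eta>)" and "P \<equiv> (t, x, u)"
  assumes TXU: "smooth_on \<Omega> T" "smooth_on \<Omega> X" "smooth_on \<Omega> U"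
    and g: "open W" "smooth_on W g"
    and Z: "open Z" "0 \<in> Z" "\<And>s. s \<in> Z \<Longrightarrow> c s \<in> \<Omega>" "\<And>s. s \<in> Z \<Longrightarrow> (T (c s), X (c s)) \<in> W"
      "\<And>s. s \<in> Z \<Longrightarrow> g (T (c s), X (c s)) = U (c s)"
  defines "q \<equiv> (T P, X P)"
  shows "dd v U P = pd_t g q * dd v T P + pd_x g q * dd v X P"
    and "dd v T P = 0 \<Longrightarrow> dd v (dd v U) P + \<omega> * dd (0, 0, 1) U P =
      pd_t g q * (dd v (dd v T) P + \<omega> * dd (0, 0, 1) T P)
      + pd_x g q * (dd v (dd v X) P + \<omega> * dd (0, 0, 1) X P) + pd_x (pd_x g) q * (dd v X P)\<^sup>2"
proof -
  \<comment> \<open>The velocity of \<open>c\<close> at \<open>s\<close> is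
    \<open>v + (s * \<omega>) *\<^sub>R (0, 0, 1)\<close>; \<open>F1 F\<close> is the derivative of
    \<open>F\<close> along \<open>c\<close>.\<close>
  define F1 where "F1 F s = dd v F (c s) + s * \<omega> * dd (0, 0, 1) F (c s)" for F s
  have c0: "c 0 = P"
    by (simp add: c_def P_def)
  have D: "((\<lambda>s. F (c s)) has_real_derivative F1 F s) (at s)" if "smooth_on \<Omega> F" "s \<in> Z" for F s
  proof -
    have "((\<lambda>s. F (c s)) has_real_derivative dd (\<alpha>, \<beta>, \<eta> + s * \<omega>) F (c s)) (at s)"
      unfolding c_def using Z(3)[OF that(2)] that(1)
      by (intro DERIV_dd) (auto simp: c_def intro!: derivative_eq_intros)
    moreover have "dd (\<alpha>, \<beta>, \<eta> + s * \<omega>) F (c s) = F1 F s"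
      using dd_scale_add[OF that(1) Z(3)[OF that(2)], of v "s * \<omega>" "(0, 0, 1)"]
      by (simp add: v_def F1_def)
    ultimately show ?thesis by simp
  qed
  have D1: "(F1 F has_real_derivative dd v (dd v F) P + \<omega> * dd (0, 0, 1) F P) (at 0)"
    if "smooth_on \<Omega> F" for F
  proof -
    note D0 = D[OF smooth_on_dd[OF that] Z(2)]
    have "((\<lambda>s. dd v F (c s) + s * \<omega> * dd (0, 0, 1) F (c s)) has_real_derivative
        F1 (dd v F) 0 + (0 * \<omega> * F1 (dd (0, 0, 1) F) 0 + \<omega> * dd (0, 0, 1) F (c 0))) (at 0)"
      by (rule derivative_eq_intros D0 refl)+ simp
    then show ?thesis
      by (simp add: F1_def[abs_def] c0)
  qed
  have eq: "F1 U s = pd_t g (T (c s), X (c s)) * F1 T s + pd_x g (T (c s), X (c s)) * F1 X s"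
    if s: "s \<in> Z" for s
    by (rule DERIV_unique_on_open[OF D[OF TXU(3) s]
          DERIV_pd_compose[OF g(2,1) Z(4)[OF s] D[OF TXU(1) s] D[OF TXU(2) s]] Z(1) s])
      (simp add: Z(5))
  then have "F1 U 0 = pd_t g q * F1 T 0 + pd_x g q * F1 X 0"
    using Z(2) by (simp add: c0 q_def)
  then show "dd v U P = pd_t g q * dd v T P + pd_x g q * dd v X P"
    by (simp add: F1_def c0)
  assume T0: "dd v T P = 0"
  have *: "F1 F 0 = dd v F P" for F
    by (simp add: F1_def c0)
  \<comment> \<open>The moved curve starts without t-velocity, so only \<open>pd_x G\<close> is
    seen. The term with \<open>pd_x (pd_t g)\<close> arising below carries the factor
    \<open>F1 T 0 = 0\<close>.\<close>
  have pd: "((\<lambda>s. G (T (c s), X (c s))) has_real_derivative pd_x G q * dd v X P) (at 0)"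
    if "smooth_on W G" for G
    using DERIV_pd_compose[OF that g(1) Z(4)[OF Z(2)] D[OF TXU(1) Z(2)] D[OF TXU(2) Z(2)]]
    by (simp add: * c0 q_def T0)
  show "dd v (dd v U) P + \<omega> * dd (0, 0, 1) U P =
      pd_t g q * (dd v (dd v T) P + \<omega> * dd (0, 0, 1) T P)
      + pd_x g q * (dd v (dd v X) P + \<omega> * dd (0, 0, 1) X P) + pd_x (pd_x g) q * (dd v X P)\<^sup>2"
  proof (rule DERIV_unique_on_open[OF D1[OF TXU(3)] _ Z(1,2) eq])
    have "((\<lambda>s. pd_t g (T (c s), X (c s)) * F1 T s + pd_x g (T (c s), X (c s)) * F1 X s) has_real_derivative
        (pd_x (pd_t g) q * dd v X P * F1 T 0 + (dd v (dd v T) P + \<omega> * dd (0, 0, 1) T P) * pd_t g (T (c 0), X (c 0)))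
        + (pd_x (pd_x g) q * dd v X P * F1 X 0 + (dd v (dd v X) P + \<omega> * dd (0, 0, 1) X P) * pd_x g (T (c 0), X (c 0)))) (at 0)"
      by (intro DERIV_add DERIV_mult pd smooth_on_pd_t smooth_on_pd_x g D1 TXU)
    then show "((\<lambda>s. pd_t g (T (c s), X (c s)) * F1 T s + pd_x g (T (c s), X (c s)) * F1 X s) has_real_derivative
        pd_t g q * (dd v (dd v T) P + \<omega> * dd (0, 0, 1) T P)
      + pd_x g q * (dd v (dd v X) P + \<omega> * dd (0, 0, 1) X P) + pd_x (pd_x g) q * (dd v X P)\<^sup>2) (at 0)"
      by (rule DERIV_cong) (simp add: * c0 q_def T0 power2_eq_square)
  qed
qed

subsection \<open>Jets of quadratic polynomials\<close>

text \<open>A second-order Taylor polynomial at \<open>P\<close>. It has no mixed term, since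
  neither equation restricts u_tx.\<close>

definition quad ::
  "real \<times> real \<times> real \<Rightarrow> real \<Rightarrow> real \<Rightarrow> real \<Rightarrow> real \<Rightarrow> real \<times> real \<Rightarrow> real" where
  "quad P ut ux utt uxx = (\<lambda>(t, x). snd (snd P) + ut * (t - fst P) + ux * (x - fst (snd P))
     + utt * (t - fst P)\<^sup>2 / 2 + uxx * (x - fst (snd P))\<^sup>2 / 2)"

lemma smooth_on_quad: "smooth_on UNIV (quad P ut ux utt uxx)"
  unfolding quad_def case_prod_beta power2_eq_square by (intro smooth_on_intros open_UNIV) auto

lemma
  shows pd_t_quad: "pd_t (quad (t, x, u) ut ux utt uxx) = (\<lambda>p. ut + utt * (fst p - t))"
    and pd_x_quad: "pd_x (quad (t, x, u) ut ux utt uxx) = (\<lambda>p. ux + uxx * (snd p - x))"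
  unfolding pd_t_def pd_x_def quad_def
  by (auto intro!: ext DERIV_imp_deriv derivative_eq_intros)

lemma quad_at [simp]: "quad (t, x, u) ut ux utt uxx (t, x) = u"
  by (simp add: quad_def)

text \<open>Over a straight line in the base the graph is exactly a curve \<open>c\<close> of
  \<open>curve_prolongation\<close>; this identifies its coefficient
  \<open>\<omega>\<close>.\<close>

lemma quad_along:
  "quad (t, x, u) ut ux utt uxx (t + s * \<alpha>, x + s * \<beta>) =
    u + s * (\<alpha> * ut + \<beta> * ux) + s\<^sup>2 * (\<alpha>\<^sup>2 * utt + \<beta>\<^sup>2 * uxx) / 2"
  by (simp add: quad_def power2_eq_square field_simps)

lemma pd_pd_quad:
  "pd_x (pd_x (quad (t, x, u) ut ux utt uxx)) p = uxx"
proof -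
  have "((\<lambda>y. ux + uxx * (y - x)) has_real_derivative uxx) (at (snd p))"
    by (auto intro!: derivative_eq_intros)
  then show ?thesis
    unfolding pd_x_quad by (cases p) (simp add: pd_x_def DERIV_imp_deriv)
qed

section \<open>Necessity\<close>

locale connected_equations =
  fixes A B A' B' :: "real \<times> real \<Rightarrow> real" and D D' :: "(real \<times> real) set"
    and \<Phi> :: "real \<times> real \<times> real \<Rightarrow> real \<times> real \<times> real" and \<Omega> :: "(real \<times> real \<times> real) set"
  assumes source: "kolmogorov_class D A B" and target: "kolmogorov_class D' A' B'"
    and pt: "point_transformation \<Omega> \<Phi>" and over: "\<Omega> \<subseteq> over D" "\<Phi> ` \<Omega> \<subseteq> over D'"
    and connects: "connects \<Omega> \<Phi> (kolmogorov_eq D A B) (kolmogorov_eq D' A' B')"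
begin

definition T where "T P = fst (\<Phi> P)"
definition X where "X P = fst (snd (\<Phi> P))"
definition U where "U P = snd (snd (\<Phi> P))"

lemma \<Phi>_eq: "\<Phi> P = (T P, X P, U P)"
  by (simp add: T_def X_def U_def)

lemma open_\<Omega>: "open \<Omega>" and smooth_\<Phi>: "smooth_on \<Omega> \<Phi>"
  using pt by (auto simp: point_transformation_def)

lemma smooth_T: "smooth_on \<Omega> T" and smooth_X: "smooth_on \<Omega> X" and smooth_U: "smooth_on \<Omega> U"
  unfolding T_def[abs_def] X_def[abs_def] U_def[abs_def]
  using open_\<Omega> smooth_\<Phi> by (intro smooth_on_intros; simp)+

lemma coeffs_nonzero:
  assumes "(t, x, u) \<in> \<Omega>"
  shows "A (t, x) \<noteq> 0" "A' (T (t, x, u), X (t, x, u)) \<noteq> 0"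
proof -
  have "(t, x) \<in> D"
    using assms over by (auto simp: over_def)
  then show "A (t, x) \<noteq> 0"
    using source by (simp add: kolmogorov_class_def)
  have "\<Phi> (t, x, u) \<in> over D'"
    using assms over by blast
  then have "(T (t, x, u), X (t, x, u)) \<in> D'"
    by (simp add: \<Phi>_eq over_def)
  then show "A' (T (t, x, u), X (t, x, u)) \<noteq> 0"
    using target by (simp add: kolmogorov_class_def)
qed

text \<open>The chain rule for \<open>\<Phi> (\<Psi> q) = q\<close> on the open image shows that the
  derivative of \<open>\<Phi>\<close> is onto. All nondegeneracy of \<open>\<Phi>\<close> enters
  necessity in this form.\<close>

lemma surjective_derivative:
  assumes "P \<in> \<Omega>"
  obtains v where "dd v T P = a" "dd v X P = b" "dd v U P = c"
proof -
  obtain \<Psi> where \<Psi>: "smooth_on (\<Phi> ` \<Omega>) \<Psi>" "\<And>p. p \<in> \<Omega> \<Longrightarrow> \<Psi> (\<Phi> p) = p"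
    using pt by (auto simp: point_transformation_def)
  have q: "\<Phi> P \<in> \<Phi> ` \<Omega>"
    using assms by (rule imageI)
  have op: "open (\<Phi> ` \<Omega>)"
    using pt by (simp add: point_transformation_def)
  let ?\<Psi>' = "frechet_derivative \<Psi> (at (\<Phi> P))" and ?\<Phi>' = "frechet_derivative \<Phi> (at P)"
  have \<Phi>': "(\<Phi> has_derivative ?\<Phi>') (at P)"
    using smooth_\<Phi> assms by (rule smooth_on_has_derivative)
  then have "(\<Phi> has_derivative ?\<Phi>') (at (\<Psi> (\<Phi> P)))"
    using \<Psi>(2)[OF assms] by simp
  from has_derivative_compose[OF smooth_on_has_derivative[OF \<Psi>(1) q] this]
  have "((\<lambda>q. \<Phi> (\<Psi> q)) has_derivative (\<lambda>w. ?\<Phi>' (?\<Psi>' w))) (at (\<Phi> P))" .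
  then have "((\<lambda>q. q) has_derivative (\<lambda>w. ?\<Phi>' (?\<Psi>' w))) (at (\<Phi> P))"
    by (rule has_derivative_transform_within_open[OF _ op q]) (use \<Psi>(2) in auto)
  from has_derivative_unique[OF this has_derivative_ident] have "?\<Phi>' (?\<Psi>' w) = w" for w
    by (rule fun_cong)
  then have "?\<Phi>' (?\<Psi>' (a, b, c)) = (a, b, c)" .
  moreover have "dd v T P = fst (?\<Phi>' v)" "dd v X P = fst (snd (?\<Phi>' v))" "dd v U P = snd (snd (?\<Phi>' v))" for v
    unfolding T_def[abs_def] X_def[abs_def] U_def[abs_def]
    by (rule dd_unique[of _ "\<lambda>v. fst (?\<Phi>' v)"] dd_unique[of _ "\<lambda>v. fst (snd (?\<Phi>' v))"]
        dd_unique[of _ "\<lambda>v. snd (snd (?\<Phi>' v))"], intro has_derivative_fst has_derivative_snd \<Phi>')+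
  ultimately show ?thesis
    using that[of "?\<Psi>' (a, b, c)"] by simp
qed

text \<open>The vectors \<open>(1, 0, ut)\<close> and \<open>(0, 1, ux)\<close> span the tangent
  plane of the graph, so \<open>jac\<close> says that the total Jacobian of (T, X) is nonzero and
  the image is locally a graph. The choice of \<open>ut\<close> puts the jet on the source equation,
  whence its image lies on the target equation.\<close>

lemma image_of_quad:
  fixes t x u ut ux utt uxx :: real
  assumes P: "(t, x, u) \<in> \<Omega>" and ut: "ut = A (t, x) * uxx + B (t, x) * ux"
    and jac: "dd (1, 0, ut) T (t, x, u) * dd (0, 1, ux) X (t, x, u)
      - dd (0, 1, ux) T (t, x, u) * dd (1, 0, ut) X (t, x, u) \<noteq> 0"
  defines "f \<equiv> quad (t, x, u) ut ux utt uxx" and "q \<equiv> (T (t, x, u), X (t, x, u))"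
  obtains V W g where "open V" "(t, x) \<in> V" "open W" "smooth_on W g"
    "lift_pt f ` V \<subseteq> \<Omega>" "\<Phi> ` lift_pt f ` V = lift_pt g ` W"
    "pd_t g q = A' q * pd_x (pd_x g) q + B' q * pd_x g q"
proof -
  have f: "smooth_on UNIV f"
    unfolding f_def by (rule smooth_on_quad)
  have lift: "lift_pt f (t, x) = (t, x, u)"
    by (simp add: lift_pt_def f_def)
  have pd: "pd_t (\<lambda>p. F (lift_pt f p)) (t, x) = dd (1, 0, ut) F (t, x, u)"
    "pd_x (\<lambda>p. F (lift_pt f p)) (t, x) = dd (0, 1, ux) F (t, x, u)" if "smooth_on \<Omega> F" for F
  proof -
    note ft = DERIV_pd_t[OF f open_UNIV UNIV_I, of x t] and fx = DERIV_pd_x[OF f open_UNIV UNIV_I, of t x]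
    have "((\<lambda>s. F (s, x, f (s, x))) has_real_derivative dd (1, 0, ut) F (t, x, f (t, x))) (at t)"
      using ft by (intro DERIV_dd[OF that]) (auto simp: P f_def pd_t_quad)
    then show "pd_t (\<lambda>p. F (lift_pt f p)) (t, x) = dd (1, 0, ut) F (t, x, u)"
      by (simp add: pd_t_def lift_pt_def DERIV_imp_deriv f_def)
    have "((\<lambda>y. F (t, y, f (t, y))) has_real_derivative dd (0, 1, ux) F (t, x, f (t, x))) (at x)"
      using fx by (intro DERIV_dd[OF that]) (auto simp: P f_def pd_x_quad)
    then show "pd_x (\<lambda>p. F (lift_pt f p)) (t, x) = dd (0, 1, ux) F (t, x, u)"
      by (simp add: pd_x_def lift_pt_def DERIV_imp_deriv f_def)
  qed
  have "lift_pt f (t, x) \<in> \<Omega>"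
    using P lift by simp
  moreover have "jac (\<lambda>p. fst (\<Phi> (lift_pt f p))) (\<lambda>p. fst (snd (\<Phi> (lift_pt f p)))) (t, x) \<noteq> 0"
    using jac unfolding jac_def T_def[symmetric] X_def[symmetric] pd[OF smooth_T] pd[OF smooth_X] .
  ultimately obtain V W g where *: "open V" "(t, x) \<in> V" "open W" "smooth_on V f" "smooth_on W g"
    "lift_pt f ` V \<subseteq> \<Omega>" "\<Phi> ` lift_pt f ` V = lift_pt g ` W"
    by (rule graph_image_exists[OF pt f])
  have \<Phi>P: "\<Phi> (lift_pt f (t, x)) = (T (t, x, u), X (t, x, u), U (t, x, u))"
    by (simp only: lift \<Phi>_eq)
  have q: "q \<in> W" "g q = U (t, x, u)"
    unfolding q_def by (rule graph_image_in_domain[OF *(7,2) \<Phi>P] graph_image_value[OF *(7,2) \<Phi>P])+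
  then have "\<Phi> (lift_pt f (t, x)) = lift_pt g q"
    unfolding \<Phi>P by (simp add: lift_pt_def q_def)
  then have "(jet2 f (t, x), jet2 g q) \<in> prolongation \<Omega> \<Phi>"
    unfolding prolongation_def using * q by blast
  moreover have "jet2 f (t, x) \<in> kolmogorov_eq D A B"
    using P over ut by (auto simp: jet2_def f_def pd_t_quad pd_x_quad pd_pd_quad[unfolded pd_x_quad] kolmogorov_eq_def over_def)
  ultimately have "jet2 g q \<in> kolmogorov_eq D' A' B'"
    using connects unfolding connects_def by blast
  then have "pd_t g q = A' q * pd_x (pd_x g) q + B' q * pd_x g q"
    by (simp add: jet2_def kolmogorov_eq_def)
  with * that show ?thesis by blast
qed

text \<open>Of the image jet only g_t, g_x and g_xx are retained. They are chosen before the
  direction, so the same three numbers serve all \<open>\<alpha>\<close>, \<open>\<beta>\<close> and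
  can be eliminated.\<close>

lemma image_jet:
  assumes P: "(t, x, u) \<in> \<Omega>" and ut: "ut = A (t, x) * uxx + B (t, x) * ux"
    and jac: "dd (1, 0, ut) T (t, x, u) * dd (0, 1, ux) X (t, x, u)
      - dd (0, 1, ux) T (t, x, u) * dd (1, 0, ut) X (t, x, u) \<noteq> 0"
  defines "q \<equiv> (T (t, x, u), X (t, x, u))"
  obtains gt gx gxx where "gt = A' q * gxx + B' q * gx"
    and "\<And>\<alpha> \<beta>. dd (\<alpha>, \<beta>, \<alpha> * ut + \<beta> * ux) U (t, x, u) =
      gt * dd (\<alpha>, \<beta>, \<alpha> * ut + \<beta> * ux) T (t, x, u) + gx * dd (\<alpha>, \<beta>, \<alpha> * ut + \<beta> * ux) X (t, x, u)"
    and "\<And>\<alpha> \<beta> v \<omega>. v = (\<alpha>, \<beta>, \<alpha> * ut + \<beta> * ux) \<Longrightarrow> \<omega> = \<alpha>\<^sup>2 * utt + \<beta>\<^sup>2 * uxx \<Longrightarrow>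
      dd v T (t, x, u) = 0 \<Longrightarrow>
      dd v (dd v U) (t, x, u) + \<omega> * dd (0, 0, 1) U (t, x, u) =
      gt * (dd v (dd v T) (t, x, u) + \<omega> * dd (0, 0, 1) T (t, x, u))
      + gx * (dd v (dd v X) (t, x, u) + \<omega> * dd (0, 0, 1) X (t, x, u)) + gxx * (dd v X (t, x, u))\<^sup>2"
proof -
  let ?f = "quad (t, x, u) ut ux utt uxx"
  obtain V W g where *: "open V" "(t, x) \<in> V" "open W" "smooth_on W g"
    "lift_pt ?f ` V \<subseteq> \<Omega>" "\<Phi> ` lift_pt ?f ` V = lift_pt g ` W"
    "pd_t g q = A' q * pd_x (pd_x g) q + B' q * pd_x g q"
    unfolding q_def by (rule image_of_quad[OF P ut jac])
  have prol: "dd v U (t, x, u) = pd_t g q * dd v T (t, x, u) + pd_x g q * dd v X (t, x, u) \<and>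
      (dd v T (t, x, u) = 0 \<longrightarrow> dd v (dd v U) (t, x, u) + \<omega> * dd (0, 0, 1) U (t, x, u) =
        pd_t g q * (dd v (dd v T) (t, x, u) + \<omega> * dd (0, 0, 1) T (t, x, u))
        + pd_x g q * (dd v (dd v X) (t, x, u) + \<omega> * dd (0, 0, 1) X (t, x, u))
        + pd_x (pd_x g) q * (dd v X (t, x, u))\<^sup>2)"
    if v: "v = (\<alpha>, \<beta>, \<alpha> * ut + \<beta> * ux)" "\<omega> = \<alpha>\<^sup>2 * utt + \<beta>\<^sup>2 * uxx" for \<alpha> \<beta> v \<omega>
  proof -
    define Z where "Z = (\<lambda>s. (t + s * \<alpha>, x + s * \<beta>)) -` V"
    let ?c = "\<lambda>s. (t + s * \<alpha>, x + s * \<beta>, u + s * (\<alpha> * ut + \<beta> * ux) + s\<^sup>2 * \<omega> / 2)"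
    have "open Z"
      unfolding Z_def using *(1) by (intro open_vimage continuous_intros)
    moreover have "0 \<in> Z"
      using *(2) by (simp add: Z_def)
    moreover have lift: "?c s = lift_pt ?f (t + s * \<alpha>, x + s * \<beta>)" for s
      by (simp add: lift_pt_def quad_along v(2))
    moreover have "?c s \<in> \<Omega>" if "s \<in> Z" for s
      using *(5) that unfolding lift Z_def by blast
    moreover have "(T (?c s), X (?c s)) \<in> W" "g (T (?c s), X (?c s)) = U (?c s)" if "s \<in> Z" for s
    proof -
      have "(t + s * \<alpha>, x + s * \<beta>) \<in> V"
        using that by (simp add: Z_def)
      note graph = graph_image_in_domain[OF *(6) this] graph_image_value[OF *(6) this]
      show "(T (?c s), X (?c s)) \<in> W" "g (T (?c s), X (?c s)) = U (?c s)"
        unfolding lift by (rule graph[OF \<Phi>_eq])+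
    qed
    ultimately show ?thesis
      using curve_prolongation[OF smooth_T smooth_X smooth_U *(3,4), of Z t \<alpha> x \<beta> u "\<alpha> * ut + \<beta> * ux" \<omega>]
      unfolding v(1) q_def by blast
  qed
  show ?thesis
    by (rule that[OF *(7)]) (use prol in blast)+
qed

end

section \<open>Functions with a vanishing derivative in a coordinate direction\<close>

lemma dd_zero:
  assumes "open \<Omega>" "P \<in> \<Omega>" "\<And>Q. Q \<in> \<Omega> \<Longrightarrow> F Q = 0"
  shows "dd v F P = 0"
proof -
  have "(F has_derivative (\<lambda>v. 0)) (at P)"
    by (rule has_derivative_transform_within_open[OF has_derivative_const[of 0] assms(1,2)])
      (simp add: assms(3))
  then show ?thesis
    by (rule dd_unique)
qed

lemma constant_in_interval:
  fixes f :: "real \<Rightarrow> real"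
  assumes "open_interval K" "a \<in> K" "b \<in> K" "\<And>s. s \<in> K \<Longrightarrow> (f has_real_derivative 0) (at s)"
  shows "f a = f b"
proof -
  have "convex K"
    using assms(1) by (simp add: open_interval_def is_interval_convex_1)
  then obtain c where "\<forall>s\<in>K. f s = c"
    using has_field_derivative_zero_constant[of K f] assms(4) by (blast intro: has_field_derivative_at_within)
  with assms(2,3) show ?thesis by simp
qed

lemma DERIV_dd_coords:
  assumes "smooth_on \<Omega> F" "(t, x, u) \<in> \<Omega>"
  shows "((\<lambda>s. F (s, x, u)) has_real_derivative dd (1, 0, 0) F (t, x, u)) (at t)"
    and "((\<lambda>s. F (t, s, u)) has_real_derivative dd (0, 1, 0) F (t, x, u)) (at x)"
    and "((\<lambda>s. F (t, x, s)) has_real_derivative dd (0, 0, 1) F (t, x, u)) (at u)"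
  using assms by (auto intro: DERIV_dd[OF assms(1)])

lemma box_neighbourhood:
  fixes \<Omega> :: "(real \<times> real \<times> real) set"
  assumes "open \<Omega>" "(t, x, u) \<in> \<Omega>"
  obtains I J K where "open_interval I" "open_interval J" "open_interval K"
    "t \<in> I" "x \<in> J" "u \<in> K" "I \<times> J \<times> K \<subseteq> \<Omega>"
proof -
  obtain I0 Y where "open I0" "open Y" "(t, x, u) \<in> I0 \<times> Y" "I0 \<times> Y \<subseteq> \<Omega>"
    by (rule open_prod_elim[OF assms])
  then have Y: "open I0" "open Y" "t \<in> I0" "(x, u) \<in> Y" "I0 \<times> Y \<subseteq> \<Omega>"
    by simp_all
  obtain J0 K0 where "open J0" "open K0" "(x, u) \<in> J0 \<times> K0" "J0 \<times> K0 \<subseteq> Y"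
    by (rule open_prod_elim[OF Y(2,4)])
  then have JK: "open J0" "open K0" "x \<in> J0" "u \<in> K0" "J0 \<times> K0 \<subseteq> Y"
    by simp_all
  have ball: "\<exists>L. open_interval L \<and> s \<in> L \<and> L \<subseteq> S" if S: "open S" "s \<in> S" for S :: "real set" and s
  proof -
    obtain e where "e > 0" "ball s e \<subseteq> S"
      using S open_contains_ball by blast
    then show ?thesis
      by (intro exI[of _ "ball s e"]) (auto simp: open_interval_def is_interval_convex_1 convex_ball)
  qed
  obtain I J K where "open_interval I" "t \<in> I" "I \<subseteq> I0" "open_interval J" "x \<in> J" "J \<subseteq> J0"
    "open_interval K" "u \<in> K" "K \<subseteq> K0"
    using ball[OF Y(1,3)] ball[OF JK(1,3)] ball[OF JK(2,4)] by metis
  note * = this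
  have "I \<times> J \<times> K \<subseteq> I0 \<times> J0 \<times> K0"
    using * by (intro Sigma_mono) auto
  also have "\<dots> \<subseteq> I0 \<times> Y"
    using JK(5) by (intro Sigma_mono) auto
  finally have "I \<times> J \<times> K \<subseteq> \<Omega>"
    using Y(5) by (rule subset_trans)
  with * show ?thesis
    by (intro that)
qed

text \<open>A special case of the symmetry of second derivatives.\<close>

lemma dd_dd_indep:
  assumes F: "smooth_on \<Omega> F" and \<Omega>: "open \<Omega>" and P: "P \<in> \<Omega>"
    and zero: "\<And>Q. Q \<in> \<Omega> \<Longrightarrow> dd (0, 0, 1) F Q = 0"
  shows "dd (0, 0, 1) (dd v F) P = 0"
proof -
  obtain t x u where txu: "P = (t, x, u)" by (cases P)
  obtain I J K where
    box: "open_interval I" "open_interval J" "open_interval K" "t \<in> I" "x \<in> J" "u \<in> K" "I \<times> J \<times> K \<subseteq> \<Omega>"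
    by (rule box_neighbourhood[OF \<Omega> P[unfolded txu]])
  have op: "open (I \<times> J \<times> K)"
    using box by (intro open_Times) (auto simp: open_interval_def)
  obtain a b c where v: "v = (a, b, c)" by (cases v)
  have const: "dd v F (t, x, s) = dd (a, b, 0) F (t, x, u)" if s: "s \<in> K" for s
  proof -
    \<comment> \<open>Flattening to the level \<open>u\<close> does not change \<open>F\<close> on
      the box. Hence the derivative of \<open>F\<close> at \<open>(t, x, s)\<close> is the one at
      \<open>(t, x, u)\<close> precomposed with the derivative of the flattening, and does not
      depend on \<open>s\<close>.\<close>
    let ?\<pi> = "\<lambda>Q :: real \<times> real \<times> real. (fst Q, fst (snd Q), u)"
    have "(F has_derivative (\<lambda>v. dd v F (t, x, u))) (at (?\<pi> (t, x, s)))"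
      using has_derivative_dd[OF F P] txu by simp
    moreover have "(?\<pi> has_derivative (\<lambda>w. (fst w, fst (snd w), 0))) (at (t, x, s))"
      by (intro has_derivative_Pair has_derivative_fst has_derivative_snd has_derivative_ident
          has_derivative_const)
    ultimately have "((\<lambda>Q. F (?\<pi> Q)) has_derivative
        (\<lambda>w. dd (fst w, fst (snd w), 0) F (t, x, u))) (at (t, x, s))"
      by (rule has_derivative_compose[rotated])
    then have "(F has_derivative (\<lambda>w. dd (fst w, fst (snd w), 0) F (t, x, u))) (at (t, x, s))"
    proof (rule has_derivative_transform_within_open[OF _ op])
      show "(t, x, s) \<in> I \<times> J \<times> K"
        using box s by simp
      fix Q assume "Q \<in> I \<times> J \<times> K"
      then obtain t' x' u' where Q: "Q = (t', x', u')" "t' \<in> I" "x' \<in> J" "u' \<in> K"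
        by auto
      have "F (t', x', u) = F (t', x', u')"
      proof (rule constant_in_interval[OF box(3,6) Q(4)])
        show "((\<lambda>s. F (t', x', s)) has_real_derivative 0) (at s)" if "s \<in> K" for s
        proof -
          have "(t', x', s) \<in> \<Omega>"
            using Q that box(7) by auto
          from DERIV_dd_coords(3)[OF F this] zero[OF this] show ?thesis by simp
        qed
      qed
      then show "F (fst Q, fst (snd Q), u) = F Q"
        by (simp add: Q(1))
    qed
    from dd_unique[OF this] show ?thesis
      by (simp add: v)
  qed
  have "0 = dd (0, 0, 1) (dd v F) (t, x, u)"
  proof (rule DERIV_unique_on_open[OF DERIV_const[of "dd (a, b, 0) F (t, x, u)"]])
    show "((\<lambda>s. dd v F (t, x, s)) has_real_derivative dd (0, 0, 1) (dd v F) (t, x, u)) (at u)"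
      using P unfolding txu by (rule DERIV_dd_coords(3)[OF smooth_on_dd[OF F]])
    show "open K" "u \<in> K"
      using box by (auto simp: open_interval_def)
  qed (rule const[symmetric])
  then show ?thesis
    unfolding txu by (rule sym)
qed

text \<open>The zero set of a nonzero affine function of (r, r') is empty or a line, so it can be
  avoided at two different abscissae. When \<open>c\<close> or \<open>b\<close> is nonzero, the
  witnesses are solved from prescribing the values 1 and 1, or 1 and 2.\<close>

lemma affine_nonzero:
  fixes a b c :: real
  assumes "a \<noteq> 0 \<or> b \<noteq> 0 \<or> c \<noteq> 0"
  obtains r s r' s' where "r \<noteq> s" "a + b * r + c * r' \<noteq> 0" "a + b * s + c * s' \<noteq> 0"
proof (cases "c = 0")
  case False
  then show ?thesis
    using that[of 0 1 "(1 - a) / c" "(1 - a - b) / c"] by simp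
next
  case c: True
  show ?thesis
  proof (cases "b = 0")
    case False
    then show ?thesis
      using that[of "(1 - a) / b" "(2 - a) / b" 0 0] c by simp
  next
    case True
    then show ?thesis
      using assms c that[of 0 1] by simp
  qed
qed

section \<open>Vanishing and nonvanishing derivatives of the components\<close>

context connected_equations
begin

text \<open>The products \<open>ut * ux\<close> cancel in the total Jacobian, which leaves an affine
  function of (\<open>ux\<close>, \<open>ut\<close>). It is nonzero for two different values of
  \<open>ux\<close>; there the affine function T_x + \<open>ux\<close> T_u vanishes by hypothesis,
  so both its coefficients are zero.\<close>

lemma transversal_jets:
  assumes P: "(t, x, u) \<in> \<Omega>"
    and zero: "\<And>ut ux. dd (1, 0, ut) T (t, x, u) * dd (0, 1, ux) X (t, x, u)
      - dd (0, 1, ux) T (t, x, u) * dd (1, 0, ut) X (t, x, u) \<noteq> 0 \<Longrightarrow> dd (0, 1, ux) T (t, x, u) = 0"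
  shows "dd (0, 1, 0) T (t, x, u) = 0" "dd (0, 0, 1) T (t, x, u) = 0"
proof -
  let ?P = "(t, x, u)"
  note cT = dd_coords[OF smooth_T P] and cX = dd_coords[OF smooth_X P]
  let ?a = "dd (1, 0, 0) T ?P * dd (0, 1, 0) X ?P - dd (0, 1, 0) T ?P * dd (1, 0, 0) X ?P"
  let ?b = "dd (1, 0, 0) T ?P * dd (0, 0, 1) X ?P - dd (0, 0, 1) T ?P * dd (1, 0, 0) X ?P"
  let ?c = "dd (0, 0, 1) T ?P * dd (0, 1, 0) X ?P - dd (0, 1, 0) T ?P * dd (0, 0, 1) X ?P"
  have *: "dd (0, 1, 0) T ?P + ux * dd (0, 0, 1) T ?P = 0" if "?a + ?b * ux + ?c * ut \<noteq> 0" for ut ux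
    using zero[of ut ux] that cT[of 1 0 ut] cX[of 1 0 ut] cT[of 0 1 ux] cX[of 0 1 ux]
    by (simp add: algebra_simps)
  have abc: "?a \<noteq> 0 \<or> ?b \<noteq> 0 \<or> ?c \<noteq> 0"
  proof (rule ccontr)
    assume "\<not> ?thesis"
    then have z: "?a = 0" "?b = 0" "?c = 0" by simp_all
    obtain v where v: "dd v T ?P = 1" "dd v X ?P = 0"
      by (rule surjective_derivative[OF P])
    obtain w where w: "dd w T ?P = 0" "dd w X ?P = 1"
      by (rule surjective_derivative[OF P])
    obtain v1 v2 v3 where v': "v = (v1, v2, v3)" by (cases v)
    obtain w1 w2 w3 where w': "w = (w1, w2, w3)" by (cases w)
    \<comment> \<open>Cauchy-Binet: the determinant of the images of \<open>v\<close> and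
      \<open>w\<close> is a combination of the minors of (T, X), with the minors of
      (\<open>v\<close>, \<open>w\<close>) as weights.\<close>
    have "1 = dd v T ?P * dd w X ?P - dd w T ?P * dd v X ?P"
      by (simp add: v w)
    also have "\<dots> = ?a * (v1 * w2 - v2 * w1) + ?b * (v1 * w3 - v3 * w1) - ?c * (v2 * w3 - v3 * w2)"
      unfolding v' w' cT[of v1] cT[of w1] cX[of v1] cX[of w1] by (simp add: algebra_simps)
    also have "\<dots> = 0"
      unfolding z by simp
    finally show False by simp
  qed
  obtain r s r' s' where "r \<noteq> s" "?a + ?b * r + ?c * r' \<noteq> 0" "?a + ?b * s + ?c * s' \<noteq> 0"
    by (rule affine_nonzero[OF abc])
  then have rs: "r \<noteq> s" "dd (0, 1, 0) T ?P + r * dd (0, 0, 1) T ?P = 0"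
    "dd (0, 1, 0) T ?P + s * dd (0, 0, 1) T ?P = 0"
    by (simp_all only: * simp_thms)
  then have "(r - s) * dd (0, 0, 1) T ?P = 0"
    by (simp only: left_diff_distrib)
  with rs(1) show "dd (0, 0, 1) T ?P = 0"
    by simp
  with rs(2) show "dd (0, 1, 0) T ?P = 0"
    by simp
qed

text \<open>The covector dU - g_t dT - g_x dX annihilates the tangent plane of the graph. If it also
  killed the u-direction, which is transversal to that plane, it would vanish, contradicting the
  independence of dT, dX, dU.\<close>

lemma conormal:
  assumes P: "(t, x, u) \<in> \<Omega>"
    and gr: "\<And>\<alpha> \<beta>. dd (\<alpha>, \<beta>, \<alpha> * ut + \<beta> * ux) U (t, x, u) =
      gt * dd (\<alpha>, \<beta>, \<alpha> * ut + \<beta> * ux) T (t, x, u) + gx * dd (\<alpha>, \<beta>, \<alpha> * ut + \<beta> * ux) X (t, x, u)"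
  shows "dd (0, 0, 1) U (t, x, u) - gt * dd (0, 0, 1) T (t, x, u) - gx * dd (0, 0, 1) X (t, x, u) \<noteq> 0"
proof
  let ?P = "(t, x, u)"
  assume z: "dd (0, 0, 1) U ?P - gt * dd (0, 0, 1) T ?P - gx * dd (0, 0, 1) X ?P = 0"
  obtain v where v: "dd v T ?P = 0" "dd v X ?P = 0" "dd v U ?P = 1"
    by (rule surjective_derivative[OF P])
  obtain a b c where v': "v = (a, b, c)" by (cases v)
  let ?d = "c - (a * ut + b * ux)"
  have split: "dd v F ?P = dd (a, b, a * ut + b * ux) F ?P + ?d * dd (0, 0, 1) F ?P" if "smooth_on \<Omega> F" for F
    using dd_scale_add[OF that P, of "(a, b, a * ut + b * ux)" ?d "(0, 0, 1)"] by (simp add: v')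
  have "dd v U ?P = gt * dd v T ?P + gx * dd v X ?P + ?d * (dd (0, 0, 1) U ?P - gt * dd (0, 0, 1) T ?P - gx * dd (0, 0, 1) X ?P)"
    unfolding split[OF smooth_T] split[OF smooth_X] split[OF smooth_U] gr
    by (simp add: algebra_simps)
  then show False
    by (simp add: v z)
qed

lemma T_derivatives:
  assumes P: "(t, x, u) \<in> \<Omega>"
  shows "dd (0, 1, 0) T (t, x, u) = 0" "dd (0, 0, 1) T (t, x, u) = 0"
proof -
  let ?P = "(t, x, u)" and ?q = "(T (t, x, u), X (t, x, u))"
  have *: "dd (0, 1, ux) T ?P = 0" if jac: "dd (1, 0, ut) T ?P * dd (0, 1, ux) X ?P
      - dd (0, 1, ux) T ?P * dd (1, 0, ut) X ?P \<noteq> 0" for ut ux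
  proof -
    let ?\<Delta> = "dd (1, 0, ut) T ?P * dd (0, 1, ux) X ?P - dd (0, 1, ux) T ?P * dd (1, 0, ut) X ?P"
    \<comment> \<open>Here \<open>ut\<close> and \<open>ux\<close> are prescribed by the Jacobian
      condition, so the equation is solved for \<open>uxx\<close>, using that A does not
      vanish.\<close>
    define uxx where "uxx = (ut - B (t, x) * ux) / A (t, x)"
    have ut: "ut = A (t, x) * uxx + B (t, x) * ux"
      using coeffs_nonzero[OF P] by (simp add: uxx_def)
    \<comment> \<open>Two jets on the source equation that differ only in \<open>u\<^sub>t\<^sub>t\<close>: their images have the same first
      derivatives, hence by the target equation the same \<open>u\<^sub>x\<^sub>x\<close>.\<close>
    obtain gt gx gxx where e1: "gt = A' ?q * gxx + B' ?q * gx"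
      and e2: "\<And>\<alpha> \<beta>. dd (\<alpha>, \<beta>, \<alpha> * ut + \<beta> * ux) U ?P =
        gt * dd (\<alpha>, \<beta>, \<alpha> * ut + \<beta> * ux) T ?P + gx * dd (\<alpha>, \<beta>, \<alpha> * ut + \<beta> * ux) X ?P"
      and e3: "\<And>\<alpha> \<beta> v \<omega>. v = (\<alpha>, \<beta>, \<alpha> * ut + \<beta> * ux) \<Longrightarrow> \<omega> = \<alpha>\<^sup>2 * 0 + \<beta>\<^sup>2 * uxx \<Longrightarrow>
        dd v T ?P = 0 \<Longrightarrow> dd v (dd v U) ?P + \<omega> * dd (0, 0, 1) U ?P =
        gt * (dd v (dd v T) ?P + \<omega> * dd (0, 0, 1) T ?P)
        + gx * (dd v (dd v X) ?P + \<omega> * dd (0, 0, 1) X ?P) + gxx * (dd v X ?P)\<^sup>2"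
      by (rule image_jet[OF P ut jac, where utt = 0]) (rule that)
    obtain gt' gx' gxx' where f1: "gt' = A' ?q * gxx' + B' ?q * gx'"
      and f2: "\<And>\<alpha> \<beta>. dd (\<alpha>, \<beta>, \<alpha> * ut + \<beta> * ux) U ?P =
        gt' * dd (\<alpha>, \<beta>, \<alpha> * ut + \<beta> * ux) T ?P + gx' * dd (\<alpha>, \<beta>, \<alpha> * ut + \<beta> * ux) X ?P"
      and f3: "\<And>\<alpha> \<beta> v \<omega>. v = (\<alpha>, \<beta>, \<alpha> * ut + \<beta> * ux) \<Longrightarrow> \<omega> = \<alpha>\<^sup>2 * 1 + \<beta>\<^sup>2 * uxx \<Longrightarrow>
        dd v T ?P = 0 \<Longrightarrow> dd v (dd v U) ?P + \<omega> * dd (0, 0, 1) U ?P =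
        gt' * (dd v (dd v T) ?P + \<omega> * dd (0, 0, 1) T ?P)
        + gx' * (dd v (dd v X) ?P + \<omega> * dd (0, 0, 1) X ?P) + gxx' * (dd v X ?P)\<^sup>2"
      by (rule image_jet[OF P ut jac, where utt = 1]) (rule that)
    have e: "(gt - gt') * dd (1, 0, ut) T ?P + (gx - gx') * dd (1, 0, ut) X ?P = 0"
      "(gt - gt') * dd (0, 1, ux) T ?P + (gx - gx') * dd (0, 1, ux) X ?P = 0"
      using e2[of 1 0] f2[of 1 0] e2[of 0 1] f2[of 0 1] by (simp_all add: algebra_simps)
    \<comment> \<open>Cramer's rule for the homogeneous system \<open>e\<close>, whose determinant
      is \<open>?\<Delta>\<close>.\<close>
    have "(gt - gt') * ?\<Delta> = 0" "(gx - gx') * ?\<Delta> = 0"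
      using e by algebra+
    with jac have g: "gt' = gt" "gx' = gx"
      by auto
    then have gxx: "gxx' = gxx"
      using e1 f1 coeffs_nonzero(2)[OF P] by simp
    \<comment> \<open>These give the tangent direction of the graph that annihilates T. Raising
      \<open>utt\<close> from 0 to 1 changes \<open>\<omega>\<close> by \<open>a\<^sup>2\<close>
      while the image numbers stay fixed, so \<open>a\<^sup>2\<close> times the nonzero conormal
      factor must vanish.\<close>
    define a b where "a = - dd (0, 1, ux) T ?P" and "b = dd (1, 0, ut) T ?P"
    define v where "v = (a, b, a * ut + b * ux)"
    have T0: "dd v T ?P = 0"
      using dd_coords[OF smooth_T P, of 0 1 ux] dd_coords[OF smooth_T P, of 1 0 ut]
      unfolding v_def dd_coords[OF smooth_T P, of a b] by (simp add: a_def b_def algebra_simps)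
    have "a\<^sup>2 * (dd (0, 0, 1) U ?P - gt * dd (0, 0, 1) T ?P - gx * dd (0, 0, 1) X ?P) = 0"
      using e3[OF v_def refl T0] f3[OF v_def refl T0] unfolding g gxx by (simp add: algebra_simps)
    with conormal[OF P e2] have "a = 0"
      by simp
    then show "dd (0, 1, ux) T ?P = 0"
      by (simp add: a_def)
  qed
  show "dd (0, 1, 0) T (t, x, u) = 0" "dd (0, 0, 1) T (t, x, u) = 0"
    by (rule transversal_jets[OF P *]; assumption)+
qed

lemma T_t_nonzero:
  assumes P: "(t, x, u) \<in> \<Omega>"
  shows "dd (1, 0, 0) T (t, x, u) \<noteq> 0"
proof
  assume z: "dd (1, 0, 0) T (t, x, u) = 0"
  obtain v where v: "dd v T (t, x, u) = 1"
    by (rule surjective_derivative[OF P])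
  obtain a b c where "v = (a, b, c)" by (cases v)
  with v z dd_coords[OF smooth_T P, of a b c] T_derivatives[OF P] show False
    by simp
qed

lemma X_x_or_X_u_nonzero:
  assumes P: "(t, x, u) \<in> \<Omega>"
  shows "dd (0, 1, 0) X (t, x, u) \<noteq> 0 \<or> dd (0, 0, 1) X (t, x, u) \<noteq> 0"
proof (rule ccontr)
  assume z: "\<not> ?thesis"
  obtain v where v: "dd v T (t, x, u) = 0" "dd v X (t, x, u) = 1"
    by (rule surjective_derivative[OF P])
  obtain a b c where v': "v = (a, b, c)" by (cases v)
  have "a = 0"
    using v(1) v' dd_coords[OF smooth_T P, of a b c] T_derivatives[OF P] T_t_nonzero[OF P] by simp
  with v(2) v' dd_coords[OF smooth_X P, of a b c] z show False
    by simp
qed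

lemma dd_dd_T:
  assumes P: "(t, x, u) \<in> \<Omega>"
  shows "dd (0, 1, ux) T (t, x, u) = 0" "dd w (dd (0, 1, ux) T) (t, x, u) = 0"
proof -
  have "dd (0, 1, ux) T Q = 0" if "Q \<in> \<Omega>" for Q
    using dd_coords[OF smooth_T that, of 0 1 ux] T_derivatives that by (cases Q) simp
  then show "dd (0, 1, ux) T (t, x, u) = 0" "dd w (dd (0, 1, ux) T) (t, x, u) = 0"
    using P dd_zero[OF open_\<Omega> P] by blast+
qed

text \<open>With T_x = T_u = 0 the total Jacobian reduces to T_t times the total x-derivative of X,
  and \<open>(0, 1, ux)\<close> annihilates T for every \<open>ux\<close>. The second-order identity
  is thus available in the x-direction of the graph.\<close>

lemma image_jet_T_of_t:
  assumes P: "(t, x, u) \<in> \<Omega>" and ut: "ut = A (t, x) * uxx + B (t, x) * ux"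
    and X': "dd (0, 1, ux) X (t, x, u) \<noteq> 0"
  defines "q \<equiv> (T (t, x, u), X (t, x, u))"
  obtains gt gx gxx where "gt = A' q * gxx + B' q * gx"
    and "dd (1, 0, ut) U (t, x, u) = gt * dd (1, 0, 0) T (t, x, u) + gx * dd (1, 0, ut) X (t, x, u)"
    and "dd (0, 1, ux) U (t, x, u) = gx * dd (0, 1, ux) X (t, x, u)"
    and "dd (0, 1, ux) (dd (0, 1, ux) U) (t, x, u) + uxx * dd (0, 0, 1) U (t, x, u) =
      gx * (dd (0, 1, ux) (dd (0, 1, ux) X) (t, x, u) + uxx * dd (0, 0, 1) X (t, x, u))
      + gxx * (dd (0, 1, ux) X (t, x, u))\<^sup>2"
    and "dd (0, 0, 1) U (t, x, u) - gx * dd (0, 0, 1) X (t, x, u) \<noteq> 0"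
proof -
  have T': "dd (1, 0, ut) T (t, x, u) = dd (1, 0, 0) T (t, x, u)"
    using dd_coords[OF smooth_T P, of 1 0 ut] T_derivatives[OF P] by simp
  have "dd (1, 0, ut) T (t, x, u) * dd (0, 1, ux) X (t, x, u)
      - dd (0, 1, ux) T (t, x, u) * dd (1, 0, ut) X (t, x, u) \<noteq> 0"
    using X' T_t_nonzero[OF P] by (simp add: T' dd_dd_T[OF P])
  then obtain gt gx gxx where 1: "gt = A' q * gxx + B' q * gx"
    and 2: "\<And>\<alpha> \<beta>. dd (\<alpha>, \<beta>, \<alpha> * ut + \<beta> * ux) U (t, x, u) =
      gt * dd (\<alpha>, \<beta>, \<alpha> * ut + \<beta> * ux) T (t, x, u) + gx * dd (\<alpha>, \<beta>, \<alpha> * ut + \<beta> * ux) X (t, x, u)"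
    and 3: "\<And>\<alpha> \<beta> v \<omega>. v = (\<alpha>, \<beta>, \<alpha> * ut + \<beta> * ux) \<Longrightarrow> \<omega> = \<alpha>\<^sup>2 * 0 + \<beta>\<^sup>2 * uxx \<Longrightarrow>
      dd v T (t, x, u) = 0 \<Longrightarrow>
      dd v (dd v U) (t, x, u) + \<omega> * dd (0, 0, 1) U (t, x, u) =
      gt * (dd v (dd v T) (t, x, u) + \<omega> * dd (0, 0, 1) T (t, x, u))
      + gx * (dd v (dd v X) (t, x, u) + \<omega> * dd (0, 0, 1) X (t, x, u)) + gxx * (dd v X (t, x, u))\<^sup>2"
    by (rule image_jet[OF P ut _, where utt = 0, folded q_def]) (rule that)
  show ?thesis
  proof (rule that[OF 1])
    show "dd (1, 0, ut) U (t, x, u) = gt * dd (1, 0, 0) T (t, x, u) + gx * dd (1, 0, ut) X (t, x, u)"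
      using 2[of 1 0] by (simp add: T')
    show "dd (0, 1, ux) U (t, x, u) = gx * dd (0, 1, ux) X (t, x, u)"
      using 2[of 0 1] by (simp add: dd_dd_T[OF P])
    show "dd (0, 1, ux) (dd (0, 1, ux) U) (t, x, u) + uxx * dd (0, 0, 1) U (t, x, u) =
      gx * (dd (0, 1, ux) (dd (0, 1, ux) X) (t, x, u) + uxx * dd (0, 0, 1) X (t, x, u))
      + gxx * (dd (0, 1, ux) X (t, x, u))\<^sup>2"
      using 3[of "(0, 1, ux)" 0 1 uxx] by (simp add: dd_dd_T[OF P] T_derivatives[OF P])
    show "dd (0, 0, 1) U (t, x, u) - gx * dd (0, 0, 1) X (t, x, u) \<noteq> 0"
      using conormal[OF P 2] by (simp add: T_derivatives[OF P])
  qed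
qed

lemma X_u_zero:
  assumes P: "(t, x, u) \<in> \<Omega>"
  shows "dd (0, 0, 1) X (t, x, u) = 0"
proof (rule ccontr)
  let ?P = "(t, x, u)" and ?q = "(T (t, x, u), X (t, x, u))"
  assume nz: "dd (0, 0, 1) X ?P \<noteq> 0"
  note cX = dd_coords[OF smooth_X P] and cU = dd_coords[OF smooth_U P]
  \<comment> \<open>Compare the coefficients of \<open>u\<^sub>x\<^sub>x\<close>; the right-hand side does not depend on \<open>u\<^sub>x\<close>.\<close>
  have *: "A (t, x) * (dd (0, 1, ux) X ?P)\<^sup>2 = A' ?q * dd (1, 0, 0) T ?P"
    if X': "dd (0, 1, ux) X ?P \<noteq> 0" for ux
  proof -
    let ?ut = "A (t, x) * 0 + B (t, x) * ux" and ?ut' = "A (t, x) * 1 + B (t, x) * ux"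
    obtain gt gx gxx where 1: "gt = A' ?q * gxx + B' ?q * gx"
      "dd (1, 0, ?ut) U ?P = gt * dd (1, 0, 0) T ?P + gx * dd (1, 0, ?ut) X ?P"
      "dd (0, 1, ux) U ?P = gx * dd (0, 1, ux) X ?P"
      "dd (0, 1, ux) (dd (0, 1, ux) U) ?P + 0 * dd (0, 0, 1) U ?P =
        gx * (dd (0, 1, ux) (dd (0, 1, ux) X) ?P + 0 * dd (0, 0, 1) X ?P) + gxx * (dd (0, 1, ux) X ?P)\<^sup>2"
      "dd (0, 0, 1) U ?P - gx * dd (0, 0, 1) X ?P \<noteq> 0"
      by (rule image_jet_T_of_t[OF P refl X']) (rule that)
    obtain gt' gx' gxx' where 2: "gt' = A' ?q * gxx' + B' ?q * gx'"
      "dd (1, 0, ?ut') U ?P = gt' * dd (1, 0, 0) T ?P + gx' * dd (1, 0, ?ut') X ?P"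
      "dd (0, 1, ux) U ?P = gx' * dd (0, 1, ux) X ?P"
      "dd (0, 1, ux) (dd (0, 1, ux) U) ?P + 1 * dd (0, 0, 1) U ?P =
        gx' * (dd (0, 1, ux) (dd (0, 1, ux) X) ?P + 1 * dd (0, 0, 1) X ?P) + gxx' * (dd (0, 1, ux) X ?P)\<^sup>2"
      by (rule image_jet_T_of_t[OF P refl X']) (rule that)
    have gx: "gx' = gx"
      using 1(3) 2(3) X' by simp
    \<comment> \<open>The conormal factor, nonzero by the last fact of \<open>1\<close>. Raising
      \<open>uxx\<close> by 1 changes the second-order identity by \<open>?\<kappa>\<close> and the
      t-identity by \<open>A (t, x) * ?\<kappa>\<close>.\<close>
    let ?\<kappa> = "dd (0, 0, 1) U ?P - gx * dd (0, 0, 1) X ?P"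
    have a: "?\<kappa> = (gxx' - gxx) * (dd (0, 1, ux) X ?P)\<^sup>2"
      using 1(4) 2(4) unfolding gx by (simp add: algebra_simps)
    have b: "A (t, x) * ?\<kappa> = (gt' - gt) * dd (1, 0, 0) T ?P"
      using 1(2) 2(2) unfolding gx cX[of 1 0 ?ut] cX[of 1 0 ?ut'] cU[of 1 0 ?ut] cU[of 1 0 ?ut']
      by (simp add: algebra_simps)
    have c: "gt' - gt = A' ?q * (gxx' - gxx)"
      using 1(1) 2(1) gx by (simp add: algebra_simps)
    have "?\<kappa> * (A (t, x) * (dd (0, 1, ux) X ?P)\<^sup>2) = A (t, x) * ?\<kappa> * (dd (0, 1, ux) X ?P)\<^sup>2"
      by (simp only: mult_ac)
    also have "\<dots> = A' ?q * dd (1, 0, 0) T ?P * ((gxx' - gxx) * (dd (0, 1, ux) X ?P)\<^sup>2)"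
      unfolding b c by (simp only: mult_ac)
    also have "\<dots> = ?\<kappa> * (A' ?q * dd (1, 0, 0) T ?P)"
      unfolding a[symmetric] by (simp only: mult_ac)
    finally show ?thesis
      using 1(5) by simp
  qed
  \<comment> \<open>As X_u is nonzero, the total x-derivative of X can be given any value
    \<open>c\<close>; the values 1 and 2 force A = 4 A.\<close>
  have "dd (0, 1, (c - dd (0, 1, 0) X ?P) / dd (0, 0, 1) X ?P) X ?P = c" for c
    using nz cX[of 0 1 "(c - dd (0, 1, 0) X ?P) / dd (0, 0, 1) X ?P"] by simp
  with *[of "(1 - dd (0, 1, 0) X ?P) / dd (0, 0, 1) X ?P"]
    *[of "(2 - dd (0, 1, 0) X ?P) / dd (0, 0, 1) X ?P"]
  have "A (t, x) = 0"
    by simp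
  with coeffs_nonzero(1)[OF P] show False
    by simp
qed

lemma X_x_nonzero: "(t, x, u) \<in> \<Omega> \<Longrightarrow> dd (0, 1, 0) X (t, x, u) \<noteq> 0"
  using X_x_or_X_u_nonzero X_u_zero by blast

lemma U_u_nonzero:
  assumes P: "(t, x, u) \<in> \<Omega>"
  shows "dd (0, 0, 1) U (t, x, u) \<noteq> 0"
proof
  assume z: "dd (0, 0, 1) U (t, x, u) = 0"
  obtain v where v: "dd v T (t, x, u) = 0" "dd v X (t, x, u) = 0" "dd v U (t, x, u) = 1"
    by (rule surjective_derivative[OF P])
  obtain a b c where v': "v = (a, b, c)" by (cases v)
  have "a = 0"
    using v(1) v' dd_coords[OF smooth_T P, of a b c] T_derivatives[OF P] T_t_nonzero[OF P] by simp
  moreover from this have "b = 0"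
    using v(2) v' dd_coords[OF smooth_X P, of a b c] X_u_zero[OF P] X_x_nonzero[OF P] by simp
  ultimately show False
    using v(3) v' dd_coords[OF smooth_U P, of a b c] z by simp
qed

text \<open>Once X_u = 0, g_x is affine in \<open>ux\<close>. For \<open>uxx = 0\<close> the target
  equation becomes a polynomial identity in \<open>ux\<close>, in which U_uu is the only source of a
  quadratic term.\<close>

lemma U_uu_zero:
  assumes P: "(t, x, u) \<in> \<Omega>"
  shows "dd (0, 0, 1) (dd (0, 0, 1) U) (t, x, u) = 0"
proof -
  let ?P = "(t, x, u)" and ?q = "(T (t, x, u), X (t, x, u))"
  let ?Xx = "dd (0, 1, 0) X ?P" and ?Xxx = "dd (0, 1, 0) (dd (0, 1, 0) X) ?P"
    and ?Tt = "dd (1, 0, 0) T ?P" and ?Xt = "dd (1, 0, 0) X ?P"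
    and ?Ut = "dd (1, 0, 0) U ?P" and ?Ux = "dd (0, 1, 0) U ?P" and ?Uu = "dd (0, 0, 1) U ?P"
    and ?Uxx = "dd (0, 1, 0) (dd (0, 1, 0) U) ?P" and ?Uuu = "dd (0, 0, 1) (dd (0, 0, 1) U) ?P"
    and ?Uxu = "dd (0, 1, 0) (dd (0, 0, 1) U) ?P + dd (0, 0, 1) (dd (0, 1, 0) U) ?P"
  note cX = dd_coords[OF smooth_X P] and cU = dd_coords[OF smooth_U P]
  have X': "dd (0, 1, ux) X ?P = ?Xx" for ux
    using cX[of 0 1 ux] X_u_zero[OF P] by simp
  \<comment> \<open>The mixed terms vanish. In one order the zero function X_u is differentiated; in
    the other, X_x is differentiated in u, which is why \<open>dd_dd_indep\<close> is
    called.\<close>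
  have XX: "dd (0, 1, ux) (dd (0, 1, ux) X) ?P = ?Xxx" for ux
  proof -
    have zero: "dd (0, 0, 1) X Q = 0" if "Q \<in> \<Omega>" for Q
      using X_u_zero that by (cases Q) simp
    have "dd (0, 0, 1) (dd (0, 1, 0) X) ?P = 0"
      by (rule dd_dd_indep[OF smooth_X open_\<Omega> P zero])
    moreover have "dd w (dd (0, 0, 1) X) ?P = 0" for w
      by (rule dd_zero[OF open_\<Omega> P zero])
    ultimately show ?thesis
      using dd_dd_scale_add[OF smooth_X open_\<Omega> P, of "(0, 1, 0)" ux "(0, 0, 1)"] by simp
  qed
  have UU: "dd (0, 1, ux) (dd (0, 1, ux) U) ?P = ?Uxx + ux * ?Uxu + ux\<^sup>2 * ?Uuu" for ux
    using dd_dd_scale_add[OF smooth_U open_\<Omega> P, of "(0, 1, 0)" ux "(0, 0, 1)"] by simp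
  define l r where "l ux = (?Ut + B (t, x) * ux * ?Uu) * ?Xx\<^sup>2" and
    "r ux = (A' ?q * (?Uxx + ux * ?Uxu + ux\<^sup>2 * ?Uuu - (?Ux + ux * ?Uu) / ?Xx * ?Xxx)
      + B' ?q * ((?Ux + ux * ?Uu) / ?Xx) * ?Xx\<^sup>2) * ?Tt + (?Ux + ux * ?Uu) / ?Xx * ?Xt * ?Xx\<^sup>2" for ux
  have eq: "l ux = r ux" for ux
  proof -
    have X'': "dd (0, 1, ux) X ?P \<noteq> 0"
      using X_x_nonzero[OF P] by (simp only: X'[of ux] not_False_eq_True)
    let ?ut = "A (t, x) * 0 + B (t, x) * ux"
    obtain gt gx gxx where 1: "gt = A' ?q * gxx + B' ?q * gx"
      "dd (1, 0, ?ut) U ?P = gt * ?Tt + gx * dd (1, 0, ?ut) X ?P"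
      "dd (0, 1, ux) U ?P = gx * dd (0, 1, ux) X ?P"
      "dd (0, 1, ux) (dd (0, 1, ux) U) ?P + 0 * dd (0, 0, 1) U ?P =
        gx * (dd (0, 1, ux) (dd (0, 1, ux) X) ?P + 0 * dd (0, 0, 1) X ?P) + gxx * (dd (0, 1, ux) X ?P)\<^sup>2"
      by (rule image_jet_T_of_t[OF P refl X'']) (rule that)
    have gx: "gx = (?Ux + ux * ?Uu) / ?Xx"
      using 1(3) X_x_nonzero[OF P] cU[of 0 1 ux] unfolding X'[of ux] by simp
    have gt: "?Ut + B (t, x) * ux * ?Uu = gt * ?Tt + gx * ?Xt"
      using 1(2) cU[of 1 0 ?ut] cX[of 1 0 ?ut] X_u_zero[OF P] by simp
    have gxx: "gxx * ?Xx\<^sup>2 = ?Uxx + ux * ?Uxu + ux\<^sup>2 * ?Uuu - gx * ?Xxx"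
      using 1(4) unfolding X'[of ux] XX[of ux] UU[of ux] by simp
    have "(?Ut + B (t, x) * ux * ?Uu) * ?Xx\<^sup>2 = (A' ?q * (gxx * ?Xx\<^sup>2) + B' ?q * gx * ?Xx\<^sup>2) * ?Tt + gx * ?Xt * ?Xx\<^sup>2"
      unfolding gt 1(1) by (simp add: algebra_simps)
    then show ?thesis
      unfolding gxx unfolding gx l_def r_def .
  qed
  \<comment> \<open>The second difference at 1, -1, 0 extracts twice the quadratic coefficient of
    \<open>r\<close>; \<open>l\<close> is affine, so its second difference is zero.\<close>
  have "2 * (A' ?q * ?Tt * ?Uuu) = r 1 + r (- 1) - 2 * r 0"
    unfolding r_def by (simp add: divide_inverse distrib_left distrib_right left_diff_distrib right_diff_distrib)
  also have "\<dots> = l 1 + l (- 1) - 2 * l 0"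
    by (simp only: eq)
  also have "\<dots> = 0"
    unfolding l_def by (simp add: distrib_left distrib_right left_diff_distrib right_diff_distrib)
  finally have "A' ?q * ?Tt * ?Uuu = 0"
    by simp
  then show ?thesis
    using coeffs_nonzero(2)[OF P] T_t_nonzero[OF P] by simp
qed

end

section \<open>Equations for the multiplier and the shift\<close>

abbreviation (input) coeffs_related where
  "coeffs_related A B A' B' I J T X U1 \<equiv>
    (\<forall>t\<in>I. \<forall>x\<in>J.
       A' (T t, X (t, x)) = (pd_x X (t, x))\<^sup>2 / deriv T t * A (t, x) \<and>
       B' (T t, X (t, x)) =
         pd_x X (t, x) / deriv T t * (B (t, x) - 2 * (pd_x U1 (t, x) / U1 (t, x)) * A (t, x))
         - (pd_t X (t, x) - pd_x (pd_x X) (t, x) * A (t, x)) / deriv T t)"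

lemma open_interval_Times: "open_interval I \<Longrightarrow> open_interval J \<Longrightarrow> open (I \<times> J)"
  by (auto simp: open_interval_def intro: open_Times)

lemma kolmogorov_solution_iff:
  "kolmogorov_solution D A B f \<longleftrightarrow>
    smooth_on D f \<and> (\<forall>p\<in>D. pd_t f p = A p * pd_x (pd_x f) p + B p * pd_x f p)"
  by (auto simp: kolmogorov_solution_def kolmogorov_eq_def jet2_def)

text \<open>
  The substitution \<open>f = v / w\<close> turns the operator of the equation into the difference of two
  operators in which \<open>B\<close> is replaced by \<open>B - 2 A w\<^sub>x / w\<close>.
\<close>

lemma kolmogorov_quotient:
  fixes v w :: "real \<times> real \<Rightarrow> real" and a b :: real
  assumes S: "open S" "p \<in> S" and v: "smooth_on S v" and w: "smooth_on S w" "\<And>p. p \<in> S \<Longrightarrow> w p \<noteq> 0"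
  defines "f \<equiv> \<lambda>p. v p / w p" and "b' \<equiv> b - 2 * a * (pd_x w p / w p)"
  shows "pd_t f p - (a * pd_x (pd_x f) p + b * pd_x f p) =
    (pd_t v p - (a * pd_x (pd_x v) p + b' * pd_x v p)) / w p
    - v p / (w p)\<^sup>2 * (pd_t w p - (a * pd_x (pd_x w) p + b' * pd_x w p))"
proof -
  obtain t x where p: "p = (t, x)" by (cases p)
  have pd_t: "pd_t f p = (pd_t v p * w p - v p * pd_t w p) / (w p * w p)"
    unfolding f_def p pd_t_def[of "\<lambda>p. v p / w p"] prod.case
    using S w(2)[OF S(2)] unfolding p
    by (intro DERIV_imp_deriv DERIV_divide DERIV_pd_t[OF v] DERIV_pd_t[OF w(1)])
  have pd_x: "pd_x f (t, y) = (pd_x v (t, y) * w (t, y) - v (t, y) * pd_x w (t, y)) / (w (t, y) * w (t, y))"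
    if "(t, y) \<in> S" for y
    unfolding f_def pd_x_def[of "\<lambda>p. v p / w p"] prod.case
    using S w(2)[OF that] that
    by (intro DERIV_imp_deriv DERIV_divide DERIV_pd_x[OF v] DERIV_pd_x[OF w(1)])
  have tx: "(t, x) \<in> S"
    using S p by simp
  note Dv = DERIV_pd_x[OF v S(1) tx] DERIV_pd_x[OF smooth_on_pd_x[OF v S(1)] S(1) tx]
  note Dw = DERIV_pd_x[OF w(1) S(1) tx] DERIV_pd_x[OF smooth_on_pd_x[OF w(1) S(1)] S(1) tx]
  have smooth_f: "smooth_on S f"
    unfolding f_def using S v w by (intro smooth_on_divide)
  have pd_xx: "pd_x (pd_x f) (t, x) =
      ((pd_x (pd_x v) (t, x) * w (t, x) + pd_x w (t, x) * pd_x v (t, x)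
         - (pd_x v (t, x) * pd_x w (t, x) + pd_x (pd_x w) (t, x) * v (t, x))) * (w (t, x) * w (t, x))
       - (pd_x v (t, x) * w (t, x) - v (t, x) * pd_x w (t, x))
         * (pd_x w (t, x) * w (t, x) + pd_x w (t, x) * w (t, x)))
      / ((w (t, x) * w (t, x)) * (w (t, x) * w (t, x)))"
    by (rule DERIV_unique_on_open[OF DERIV_pd_x[OF smooth_on_pd_x[OF smooth_f S(1)] S(1) tx]
          DERIV_divide[OF DERIV_diff[OF DERIV_mult[OF Dv(2) Dw(1)] DERIV_mult[OF Dv(1) Dw(2)]]
            DERIV_mult[OF Dw(1) Dw(1)]] open_slices(2)[OF S(1), of t]])
      (use pd_x w(2) tx in auto)
  show ?thesis
    unfolding pd_t unfolding p pd_x[OF tx] pd_xx b'_def using w(2)[OF tx]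
    by (simp add: field_simps power2_eq_square)
qed

lemma eq_iff_of_diff:
  fixes x y z z' k :: real
  assumes "x - y = k * (z - z')" "k \<noteq> 0"
  shows "x = y \<longleftrightarrow> z = z'"
  using assms by auto

text \<open>Taking v = 1 in \<open>kolmogorov_quotient\<close>, the operator applied to v
  disappears, and 1 / w is a solution exactly when w satisfies the equation with the modified
  first-order coefficient. In that case the second operator drops out for every v, so v / w is a
  solution exactly when v satisfies the same modified equation.\<close>

lemma
  assumes S: "open S" and v: "smooth_on S v" and w: "smooth_on S w" "\<And>p. p \<in> S \<Longrightarrow> w p \<noteq> 0"
  shows kolmogorov_solution_inverse_iff: "kolmogorov_solution S A B (\<lambda>p. 1 / w p) \<longleftrightarrow>
      (\<forall>p\<in>S. pd_t w p = A p * pd_x (pd_x w) p + (B p - 2 * A p * (pd_x w p / w p)) * pd_x w p)"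
    and kolmogorov_solution_quotient_iff: "kolmogorov_solution S A B (\<lambda>p. 1 / w p) \<Longrightarrow>
      kolmogorov_solution S A B (\<lambda>p. v p / w p) \<longleftrightarrow>
      (\<forall>p\<in>S. pd_t v p = A p * pd_x (pd_x v) p + (B p - 2 * A p * (pd_x w p / w p)) * pd_x v p)"
proof -
  have one: "pd_t (\<lambda>p. 1) = (\<lambda>p. 0)" "pd_x (\<lambda>p. c) = (\<lambda>p. 0)" for c
    by (auto simp: pd_t_def pd_x_def)
  have *: "pd_t (\<lambda>p. 1 / w p) p = A p * pd_x (pd_x (\<lambda>p. 1 / w p)) p + B p * pd_x (\<lambda>p. 1 / w p) p \<longleftrightarrow>
      pd_t w p = A p * pd_x (pd_x w) p + (B p - 2 * A p * (pd_x w p / w p)) * pd_x w p" if "p \<in> S" for p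
    by (rule eq_iff_of_diff[of _ _ "- 1 / (w p)\<^sup>2"])
      (use kolmogorov_quotient[OF S that smooth_on_const[OF S, of 1] w, of "A p" "B p"] w(2)[OF that]
        in \<open>simp_all add: one\<close>)
  show inv: "kolmogorov_solution S A B (\<lambda>p. 1 / w p) \<longleftrightarrow>
      (\<forall>p\<in>S. pd_t w p = A p * pd_x (pd_x w) p + (B p - 2 * A p * (pd_x w p / w p)) * pd_x w p)"
    unfolding kolmogorov_solution_iff using smooth_on_divide[OF S smooth_on_const[OF S] w] * by simp
  assume "kolmogorov_solution S A B (\<lambda>p. 1 / w p)"
  then have w': "pd_t w p = A p * pd_x (pd_x w) p + (B p - 2 * A p * (pd_x w p / w p)) * pd_x w p"
    if "p \<in> S" for p
    using that unfolding inv by simp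
  have "pd_t (\<lambda>p. v p / w p) p = A p * pd_x (pd_x (\<lambda>p. v p / w p)) p + B p * pd_x (\<lambda>p. v p / w p) p \<longleftrightarrow>
      pd_t v p = A p * pd_x (pd_x v) p + (B p - 2 * A p * (pd_x w p / w p)) * pd_x v p" if "p \<in> S" for p
    by (rule eq_iff_of_diff[of _ _ "1 / w p"])
      (use kolmogorov_quotient[OF S that v w, of "A p" "B p"] w(2)[OF that] w'[OF that] in simp_all)
  then show "kolmogorov_solution S A B (\<lambda>p. v p / w p) \<longleftrightarrow>
      (\<forall>p\<in>S. pd_t v p = A p * pd_x (pd_x v) p + (B p - 2 * A p * (pd_x w p / w p)) * pd_x v p)"
    unfolding kolmogorov_solution_iff using smooth_on_divide[OF S v w] by simp
qed

text \<open>The letters \<open>w\<close>, \<open>w'\<close>, \<open>wx\<close>, \<open>wxx\<close>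
  stand for U1 with its t- and x-derivatives, and those with v for U0. Here \<open>ux\<close> and
  \<open>uxx\<close> are free, whereas \<open>u\<close> ranges over \<open>K\<close> only; two
  values of it isolate its coefficient.\<close>

lemma compare_coefficients:
  fixes a b c :: real
  assumes eq: "\<And>u ux uxx. u \<in> K \<Longrightarrow> w' * u + w * (a * uxx + b * ux) + v' =
      a' * (wxx * u + 2 * wx * ux + w * uxx + vxx) + c * (wx * u + w * ux + vx)"
    and K: "u0 \<in> K" "u1 \<in> K" "u0 \<noteq> u1" and w: "w \<noteq> 0"
  shows "a' = a" "c = b - 2 * a * (wx / w)" "w' = a * wxx + c * wx" "v' = a * vxx + c * vx"
proof -
  have "w * a = w * a'"
    using eq[OF K(1), of 0 0] eq[OF K(1), of 1 0] by algebra
  with w show a: "a' = a"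
    by simp
  have "w * b = 2 * a * wx + c * w"
    using eq[OF K(1), of 0 0] eq[OF K(1), of 0 1] unfolding a by algebra
  with w show "c = b - 2 * a * (wx / w)"
    by (simp add: field_simps)
  have "(u1 - u0) * w' = (u1 - u0) * (a * wxx + c * wx)"
    using eq[OF K(1), of 0 0] eq[OF K(2), of 0 0] unfolding a by algebra
  with K show w': "w' = a * wxx + c * wx"
    by simp
  show "v' = a * vxx + c * vx"
    using eq[OF K(1), of 0 0] unfolding a w' by algebra
qed

lemma smooth_on_deriv:
  fixes T :: "real \<Rightarrow> real"
  assumes "open I" "smooth_on I T"
  shows "smooth_on I (deriv T)"
proof (rule smooth_on_cong[OF assms(1) _ smooth_on_frechet_derivative[OF assms(2), of 1]])
  fix t assume t: "t \<in> I"
  have "(T has_derivative (*) (deriv T t)) (at t)"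
    using smooth_on_DERIV[OF assms(2) t] by (simp add: has_field_derivative_def)
  from frechet_derivative_at[OF this, symmetric] show "frechet_derivative T (at t) 1 = deriv T t"
    by simp
qed

section \<open>Parameters of the affine form on a box\<close>

context connected_equations
begin

context
  fixes I J K x0 u0
  assumes box: "open_interval I" "open_interval J" "open_interval K" "I \<times> J \<times> K \<subseteq> \<Omega>"
    and x0: "x0 \<in> J" and u0: "u0 \<in> K"
begin

text \<open>The base values \<open>x0\<close>, \<open>u0\<close> only select representatives: inside
  the box, T does not depend on x and u, and X and U_u do not depend on u.\<close>

definition T_box where "T_box t = T (t, x0, u0)"
definition X_box where "X_box p = X (fst p, snd p, u0)"
definition U1_box where "U1_box p = dd (0, 0, 1) U (fst p, snd p, u0)"
definition U0_box where "U0_box p = U (fst p, snd p, u0) - U1_box p * u0"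

lemma in_box: "t \<in> I \<Longrightarrow> x \<in> J \<Longrightarrow> u \<in> K \<Longrightarrow> (t, x, u) \<in> \<Omega>"
  using box(4) by auto

text \<open>The factors of the box are intervals, so vanishing partial derivatives integrate to
  constancy: T along u and x, X along u, U_u along u, and finally U - U_u u along u.\<close>

lemma affine_in_box:
  assumes t: "t \<in> I" and x: "x \<in> J" and u: "u \<in> K"
  shows "\<Phi> (t, x, u) = affine_map T_box X_box U1_box U0_box (t, x, u)"
proof -
  have "T (t, x, u) = T (t, x, u0)"
    using DERIV_dd_coords(3)[OF smooth_T in_box[OF t x]] T_derivatives(2)[OF in_box[OF t x]]
    by (intro constant_in_interval[OF box(3) u u0]) simp
  also have "\<dots> = T (t, x0, u0)"
    using DERIV_dd_coords(2)[OF smooth_T in_box[OF t _ u0]] T_derivatives(1)[OF in_box[OF t _ u0]]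
    by (intro constant_in_interval[OF box(2) x x0]) simp
  finally have T: "T (t, x, u) = T_box t"
    by (simp add: T_box_def)
  have X: "X (t, x, u) = X_box (t, x)"
    unfolding X_box_def fst_conv snd_conv
    using DERIV_dd_coords(3)[OF smooth_X in_box[OF t x]] X_u_zero[OF in_box[OF t x]]
    by (intro constant_in_interval[OF box(3) u u0]) simp
  have U1: "dd (0, 0, 1) U (t, x, s) = U1_box (t, x)" if "s \<in> K" for s
    unfolding U1_box_def fst_conv snd_conv
  proof (rule constant_in_interval[OF box(3) that u0])
    fix r assume "r \<in> K"
    note P = in_box[OF t x this]
    show "((\<lambda>r. dd (0, 0, 1) U (t, x, r)) has_real_derivative 0) (at r)"
      using DERIV_dd_coords(3)[OF smooth_on_dd[OF smooth_U] P, of "(0, 0, 1)"] U_uu_zero[OF P] by simp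
  qed
  have "U (t, x, u) - U1_box (t, x) * u = U (t, x, u0) - U1_box (t, x) * u0"
  proof (rule constant_in_interval[OF box(3) u u0])
    fix s assume s: "s \<in> K"
    have "((\<lambda>s. U (t, x, s)) has_real_derivative U1_box (t, x)) (at s)"
      using DERIV_dd_coords(3)[OF smooth_U in_box[OF t x s]] by (simp only: U1[OF s])
    from DERIV_diff[OF this DERIV_cmult_Id[of "U1_box (t, x)"]]
    show "((\<lambda>s. U (t, x, s) - U1_box (t, x) * s) has_real_derivative 0) (at s)"
      by simp
  qed
  then have "U (t, x, u) = U1_box (t, x) * u + U0_box (t, x)"
    by (simp add: U0_box_def)
  with T X show ?thesis
    by (simp add: affine_map_def \<Phi>_eq)
qed

lemma open_box: "open I" "open J" "open K" "open (I \<times> J)"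
  using box by (auto simp: open_interval_def intro: open_Times)

lemma smooth_box:
  "smooth_on I T_box" "smooth_on (I \<times> J) X_box" "smooth_on (I \<times> J) U1_box" "smooth_on (I \<times> J) U0_box"
proof -
  have "smooth_on I (\<lambda>t. T (t, x0, u0))"
    by (rule smooth_on_compose[OF open_box(1) open_\<Omega> _ smooth_T])
      (use in_box x0 u0 open_box in \<open>auto intro!: smooth_on_intros\<close>)
  then show "smooth_on I T_box"
    by (simp only: T_box_def[abs_def])
  have *: "smooth_on (I \<times> J) (\<lambda>p. F (fst p, snd p, u0))" if "smooth_on \<Omega> F" for F :: "_ \<Rightarrow> real"
    by (rule smooth_on_compose[OF open_box(4) open_\<Omega> _ that])
      (use in_box u0 open_box in \<open>auto intro!: smooth_on_intros\<close>)
  show "smooth_on (I \<times> J) X_box" and U1: "smooth_on (I \<times> J) U1_box"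
    unfolding X_box_def[abs_def] U1_box_def[abs_def] by (intro * smooth_X smooth_on_dd smooth_U)+
  from U1 show "smooth_on (I \<times> J) U0_box"
    unfolding U0_box_def[abs_def] by (intro smooth_on_intros open_box * smooth_U)
qed

lemma box_nonzero:
  assumes t: "t \<in> I" and x: "x \<in> J"
  shows "deriv T_box t \<noteq> 0" "pd_x X_box (t, x) \<noteq> 0" "U1_box (t, x) \<noteq> 0"
proof -
  have "deriv T_box t = dd (1, 0, 0) T (t, x0, u0)"
    unfolding T_box_def[abs_def]
    by (intro DERIV_imp_deriv DERIV_dd_coords(1)[OF smooth_T] in_box t x0 u0)
  then show "deriv T_box t \<noteq> 0"
    using T_t_nonzero[OF in_box[OF t x0 u0]] by simp
  have "pd_x X_box (t, x) = dd (0, 1, 0) X (t, x, u0)"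
    unfolding X_box_def[abs_def] pd_x_def prod.case fst_conv snd_conv
    by (intro DERIV_imp_deriv DERIV_dd_coords(2)[OF smooth_X] in_box t x u0)
  then show "pd_x X_box (t, x) \<noteq> 0"
    using X_x_nonzero[OF in_box[OF t x u0]] by simp
  show "U1_box (t, x) \<noteq> 0"
    using U_u_nonzero[OF in_box[OF t x u0]] by (simp add: U1_box_def)
qed

lemma box_prolongation:
  assumes t: "t \<in> I" and x: "x \<in> J" and u: "u \<in> K"
  defines "p \<equiv> (t, x)" and "q \<equiv> (T_box t, X_box (t, x))"
  obtains gt gx gxx where "gt = A' q * gxx + B' q * gx"
    and "gt * deriv T_box t + gx * pd_t X_box p =
      pd_t U1_box p * u + U1_box p * (A p * uxx + B p * ux) + pd_t U0_box p"
    and "gx * pd_x X_box p = pd_x U1_box p * u + U1_box p * ux + pd_x U0_box p"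
    and "gxx * (pd_x X_box p)\<^sup>2 + gx * pd_x (pd_x X_box) p =
      pd_x (pd_x U1_box) p * u + 2 * pd_x U1_box p * ux + U1_box p * uxx + pd_x (pd_x U0_box) p"
proof -
  note P = in_box[OF t x u]
  define ut where "ut = A (t, x) * uxx + B (t, x) * ux"
  have "dd (1, 0, ut) T (t, x, u) * dd (0, 1, ux) X (t, x, u)
      - dd (0, 1, ux) T (t, x, u) * dd (1, 0, ut) X (t, x, u) \<noteq> 0"
    using T_t_nonzero[OF P] X_x_nonzero[OF P] T_derivatives[OF P] X_u_zero[OF P]
      dd_coords[OF smooth_T P, of 1 0 ut] dd_coords[OF smooth_X P, of 0 1 ux]
    by (simp add: dd_dd_T[OF P])
  define f where "f = quad (t, x, u) ut ux 0 uxx"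
  have TX: "T (t, x, u) = T_box t" "X (t, x, u) = X_box (t, x)"
    using affine_in_box[OF t x u] by (simp_all add: affine_map_def \<Phi>_eq)
  obtain V W g where g: "open V" "(t, x) \<in> V" "open W" "smooth_on W g"
    "lift_pt f ` V \<subseteq> \<Omega>" "\<Phi> ` lift_pt f ` V = lift_pt g ` W"
    "pd_t g q = A' q * pd_x (pd_x g) q + B' q * pd_x g q"
    using image_of_quad[OF P ut_def \<open>_ \<noteq> 0\<close>, of 0] unfolding f_def q_def TX by blast
  have f: "smooth_on V f"
    unfolding f_def by (rule smooth_on_subset[OF smooth_on_quad]) simp
  \<comment> \<open>Over \<open>N\<close> the graph of \<open>f\<close> stays inside the box, where
    the affine form of \<open>\<Phi>\<close> is available.\<close>
  define N where "N = (V \<inter> f -` K) \<inter> (I \<times> J)"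
  have N: "open N"
    unfolding N_def using smooth_on_imp_continuous_on[OF f] g(1) open_box
    by (intro open_Int continuous_open_preimage)
  have txN: "(t, x) \<in> N"
    using g(2) t x u by (simp add: N_def f_def)
  have N': "N \<subseteq> I \<times> J" "N \<subseteq> V"
    by (auto simp: N_def)
  have graph: "\<forall>p\<in>N. fst p \<in> I \<and> (T_box (fst p), X_box p) \<in> W \<and>
    g (T_box (fst p), X_box p) = U1_box p * f p + U0_box p"
  proof
    fix p assume "p \<in> N"
    then obtain s y where sy: "p = (s, y)" "(s, y) \<in> V" "s \<in> I" "y \<in> J" "f (s, y) \<in> K"
      by (cases p) (auto simp: N_def)
    have "\<Phi> (lift_pt f (s, y)) = (T_box s, X_box (s, y), U1_box (s, y) * f (s, y) + U0_box (s, y))"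
      using affine_in_box[OF sy(3-5)] by (simp add: lift_pt_def affine_map_def)
    from graph_image_in_domain[OF g(6) sy(2) this] graph_image_value[OF g(6) sy(2) this]
    show "fst p \<in> I \<and> (T_box (fst p), X_box p) \<in> W \<and> g (T_box (fst p), X_box p) = U1_box p * f p + U0_box p"
      using sy(3) by (simp add: sy(1))
  qed
  note prol = affine_prolongation[OF open_box(1) smooth_box(1) open_box(4) smooth_box(2-4) g(1) f
      g(3,4) N txN N' graph, folded q_def p_def]
  have jet: "f p = u" "pd_t f p = A p * uxx + B p * ux" "pd_x f p = ux" "pd_x (pd_x f) p = uxx"
    by (simp_all add: f_def p_def pd_t_quad pd_pd_quad, simp_all add: pd_x_quad ut_def)
  show ?thesis
    by (rule that[OF g(7)]) (use prol in \<open>simp_all only: jet\<close>)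
qed

lemma box_coefficients:
  assumes t: "t \<in> I" and x: "x \<in> J"
  defines "p \<equiv> (t, x)" and "q \<equiv> (T_box t, X_box (t, x))"
  shows "A' q = (pd_x X_box p)\<^sup>2 / deriv T_box t * A p"
    and "B' q = pd_x X_box p / deriv T_box t * (B p - 2 * (pd_x U1_box p / U1_box p) * A p)
      - (pd_t X_box p - pd_x (pd_x X_box) p * A p) / deriv T_box t"
    and "pd_t U1_box p = A p * pd_x (pd_x U1_box) p
      + (B p - 2 * A p * (pd_x U1_box p / U1_box p)) * pd_x U1_box p"
    and "pd_t U0_box p = A p * pd_x (pd_x U0_box) p
      + (B p - 2 * A p * (pd_x U1_box p / U1_box p)) * pd_x U0_box p"
proof -
  note nz = box_nonzero[OF t x, folded p_def]
  let ?\<tau> = "deriv T_box t" and ?\<xi> = "pd_x X_box p"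
  \<comment> \<open>Pulled back to (t, x), the target equation for v = U1 f + U0 reads v_t =
    \<open>a\<close> v_xx + \<open>c\<close> v_x. The values of \<open>a\<close> and
    \<open>c\<close> come from multiplying it by T_t and eliminating g_xx and g_x.\<close>
  define a where "a = A' q * ?\<tau> / ?\<xi>\<^sup>2"
  define c where "c = (B' q * ?\<tau> + pd_t X_box p - a * pd_x (pd_x X_box) p) / ?\<xi>"
  have eq: "pd_t U1_box p * u + U1_box p * (A p * uxx + B p * ux) + pd_t U0_box p =
      a * (pd_x (pd_x U1_box) p * u + 2 * pd_x U1_box p * ux + U1_box p * uxx + pd_x (pd_x U0_box) p)
      + c * (pd_x U1_box p * u + U1_box p * ux + pd_x U0_box p)" if u: "u \<in> K" for u ux uxx
  proof -
    obtain gt gx gxx where g: "gt = A' q * gxx + B' q * gx"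
      "gt * ?\<tau> + gx * pd_t X_box p =
        pd_t U1_box p * u + U1_box p * (A p * uxx + B p * ux) + pd_t U0_box p"
      "gx * ?\<xi> = pd_x U1_box p * u + U1_box p * ux + pd_x U0_box p"
      "gxx * ?\<xi>\<^sup>2 + gx * pd_x (pd_x X_box) p =
        pd_x (pd_x U1_box) p * u + 2 * pd_x U1_box p * ux + U1_box p * uxx + pd_x (pd_x U0_box) p"
      by (rule box_prolongation[OF t x u, folded p_def q_def]) (rule that)
    have a: "a * ?\<xi>\<^sup>2 = A' q * ?\<tau>"
      using nz by (simp add: a_def)
    have c: "c * ?\<xi> = B' q * ?\<tau> + pd_t X_box p - a * pd_x (pd_x X_box) p"
      using nz by (simp add: c_def)
    show ?thesis
      unfolding g(2)[symmetric] g(3)[symmetric] g(4)[symmetric] unfolding g(1)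
      using a c by algebra
  qed
  \<comment> \<open>Provides the second value of u that separates U1 from U0.\<close>
  obtain e where e: "e > 0" "ball u0 e \<subseteq> K"
    using open_box(3) u0 open_contains_ball by blast
  have "u0 + e / 2 \<in> ball u0 e"
    using e(1) by (simp add: dist_real_def)
  then have u1: "u0 + e / 2 \<in> K" "u0 \<noteq> u0 + e / 2"
    using e by auto
  have *: "a = A p" "c = B p - 2 * A p * (pd_x U1_box p / U1_box p)"
    "pd_t U1_box p = A p * pd_x (pd_x U1_box) p + c * pd_x U1_box p"
    "pd_t U0_box p = A p * pd_x (pd_x U0_box) p + c * pd_x U0_box p"
    by (rule compare_coefficients[OF eq u0 u1 nz(3)], assumption)+
  have "A' q * ?\<tau> / ?\<xi>\<^sup>2 = A p"
    using *(1) by (simp only: a_def)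
  then show "A' q = ?\<xi>\<^sup>2 / ?\<tau> * A p"
    using nz by (simp add: field_simps)
  have "B' q * ?\<tau> + pd_t X_box p - A p * pd_x (pd_x X_box) p =
      ?\<xi> * (B p - 2 * A p * (pd_x U1_box p / U1_box p))"
  proof -
    have "c * ?\<xi> = B' q * ?\<tau> + pd_t X_box p - a * pd_x (pd_x X_box) p"
      using nz by (simp add: c_def)
    then show ?thesis
      unfolding *(1,2) by (simp only: mult.commute)
  qed
  then have "B' q = (?\<xi> * (B p - 2 * A p * (pd_x U1_box p / U1_box p))
      - pd_t X_box p + A p * pd_x (pd_x X_box) p) / ?\<tau>"
    using nz(1) by (simp add: eq_divide_eq algebra_simps)
  then show "B' q = ?\<xi> / ?\<tau> * (B p - 2 * (pd_x U1_box p / U1_box p) * A p)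
      - (pd_t X_box p - pd_x (pd_x X_box) p * A p) / ?\<tau>"
    using nz(1) by (simp add: diff_divide_distrib add_divide_distrib algebra_simps)
  show "pd_t U1_box p = A p * pd_x (pd_x U1_box) p
      + (B p - 2 * A p * (pd_x U1_box p / U1_box p)) * pd_x U1_box p"
    "pd_t U0_box p = A p * pd_x (pd_x U0_box) p
      + (B p - 2 * A p * (pd_x U1_box p / U1_box p)) * pd_x U0_box p"
    using *(3,4) unfolding *(2) .
qed

lemma box_admissible: "admissible_params A B I J T_box X_box U1_box U0_box"
proof -
  have nz: "U1_box p \<noteq> 0" if "p \<in> I \<times> J" for p
    using box_nonzero(3) that by auto
  have U1: "kolmogorov_solution (I \<times> J) A B (\<lambda>p. 1 / U1_box p)"
    using box_coefficients(3)
    by (subst kolmogorov_solution_inverse_iff[OF open_box(4) smooth_box(3,3) nz]) auto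
  have "kolmogorov_solution (I \<times> J) A B (\<lambda>p. U0_box p / U1_box p)"
    using box_coefficients(4)
    by (subst kolmogorov_solution_quotient_iff[OF open_box(4) smooth_box(4,3) nz U1]) auto
  with U1 show ?thesis
    unfolding admissible_params_def using smooth_box box_nonzero by auto
qed

end

lemma locally_affine:
  assumes "open_interval I" "open_interval J" "open_interval K" "I \<times> J \<times> K \<subseteq> \<Omega>"
  shows "\<exists>T X U1 U0. admissible_params A B I J T X U1 U0 \<and>
    (\<forall>p \<in> I \<times> J \<times> K. \<Phi> p = affine_map T X U1 U0 p) \<and> coeffs_related A B A' B' I J T X U1"
proof -
  obtain x0 u0 where "x0 \<in> J" "u0 \<in> K"
    using assms by (auto simp: open_interval_def)
  note box = assms this
  have "admissible_params A B I J (T_box x0 u0) (X_box u0) (U1_box u0) (U0_box u0)"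
    by (rule box_admissible[OF box])
  moreover have "\<forall>p \<in> I \<times> J \<times> K. \<Phi> p = affine_map (T_box x0 u0) (X_box u0) (U1_box u0) (U0_box u0) p"
    using affine_in_box[OF box] by auto
  moreover have "coeffs_related A B A' B' I J (T_box x0 u0) (X_box u0) (U1_box u0)"
    by (intro ballI conjI box_coefficients(1,2)[OF box])
  ultimately show ?thesis
    by (intro exI conjI)
qed

end

section \<open>Sufficiency\<close>

lemma admissible_paramsD:
  assumes "admissible_params A B I J T X U1 U0"
  shows "smooth_on I T" "smooth_on (I \<times> J) X" "smooth_on (I \<times> J) U1" "smooth_on (I \<times> J) U0"
    and "\<And>t x. t \<in> I \<Longrightarrow> x \<in> J \<Longrightarrow> deriv T t \<noteq> 0"
    and "\<And>t x. t \<in> I \<Longrightarrow> x \<in> J \<Longrightarrow> pd_x X (t, x) \<noteq> 0"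
    and "\<And>p. p \<in> I \<times> J \<Longrightarrow> U1 p \<noteq> 0"
    and "kolmogorov_solution (I \<times> J) A B (\<lambda>p. 1 / U1 p)"
    and "kolmogorov_solution (I \<times> J) A B (\<lambda>p. U0 p / U1 p)"
  using assms unfolding admissible_params_def by auto

text \<open>The defects of the two equations are proportional with the nonvanishing factor U1 / T_t.
  The equations satisfied by U1 and U0 remove exactly the terms in which f is undifferentiated or
  absent.\<close>

lemma equation_preserved:
  assumes I: "open_interval I" and J: "open_interval J"
    and adm: "admissible_params A B I J T X U1 U0" and rel: "coeffs_related A B A' B' I J T X U1"
    and f: "open V" "smooth_on V f" and g: "open W" "smooth_on W g"
    and N: "open N" "p \<in> N" "N \<subseteq> I \<times> J" "N \<subseteq> V"
    and graph: "\<forall>p\<in>N. fst p \<in> I \<and> (T (fst p), X p) \<in> W \<and> g (T (fst p), X p) = U1 p * f p + U0 p"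
  defines "q \<equiv> (T (fst p), X p)"
  shows "pd_t g q = A' q * pd_x (pd_x g) q + B' q * pd_x g q \<longleftrightarrow>
    pd_t f p = A p * pd_x (pd_x f) p + B p * pd_x f p"
proof -
  obtain t x where p: "p = (t, x)" by (cases p)
  have tx: "t \<in> I" "x \<in> J" "(t, x) \<in> I \<times> J"
    using N(2,3) p by auto
  note S = open_interval_Times[OF I J]
  note adm' = admissible_paramsD[OF adm]
  have "open I"
    using I by (simp add: open_interval_def)
  note prol = affine_prolongation[OF this adm'(1) S adm'(2-4) f g N(1) N(2)[unfolded p] N(3,4) graph]
  have "\<forall>p\<in>I \<times> J. pd_t U1 p = A p * pd_x (pd_x U1) p + (B p - 2 * A p * (pd_x U1 p / U1 p)) * pd_x U1 p"
    by (rule iffD1[OF kolmogorov_solution_inverse_iff[OF S adm'(3,3)] adm'(8)]) (rule adm'(7))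
  then have U1: "pd_t U1 p = A p * pd_x (pd_x U1) p + (B p - 2 * A p * (pd_x U1 p / U1 p)) * pd_x U1 p"
    unfolding p using tx(3) by (rule bspec)
  have "\<forall>p\<in>I \<times> J. pd_t U0 p = A p * pd_x (pd_x U0) p + (B p - 2 * A p * (pd_x U1 p / U1 p)) * pd_x U0 p"
    by (rule iffD1[OF kolmogorov_solution_quotient_iff[OF S adm'(4,3) _ adm'(8)] adm'(9)]) (rule adm'(7))
  then have U0: "pd_t U0 p = A p * pd_x (pd_x U0) p + (B p - 2 * A p * (pd_x U1 p / U1 p)) * pd_x U0 p"
    unfolding p using tx(3) by (rule bspec)
  define \<tau> \<xi> w where "\<tau> = deriv T t" and "\<xi> = pd_x X p" and "w = pd_x U1 p / U1 p"
  have nz: "\<tau> \<noteq> 0" "\<xi> \<noteq> 0" "U1 p \<noteq> 0"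
    using adm'(5-7) tx by (auto simp: \<tau>_def \<xi>_def p)
  have w: "w * U1 p = pd_x U1 p"
    using nz by (simp add: w_def)
  have q: "q = (T t, X (t, x))"
    by (simp add: q_def p)
  have "A' q = \<xi>\<^sup>2 / \<tau> * A p" and
    B': "B' q = \<xi> / \<tau> * (B p - 2 * w * A p) - (pd_t X p - pd_x (pd_x X) p * A p) / \<tau>"
    using rel tx by (simp_all add: q p \<tau>_def \<xi>_def w_def)
  then have A': "\<tau> * A' q = \<xi>\<^sup>2 * A p"
    using nz by simp
  \<comment> \<open>Clearing denominators turns all ingredients into polynomial identities, from
    which the proportionality of defects is an ideal membership.\<close>
  have "\<tau> * B' q = \<tau> * (\<xi> / \<tau>) * (B p - 2 * w * A p) - \<tau> * ((pd_t X p - pd_x (pd_x X) p * A p) / \<tau>)"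
    unfolding B' by (simp only: right_diff_distrib mult.assoc)
  then have B': "\<tau> * B' q = \<xi> * (B p - 2 * w * A p) - (pd_t X p - pd_x (pd_x X) p * A p)"
    using nz by simp
  have "\<tau> * (pd_t g q - (A' q * pd_x (pd_x g) q + B' q * pd_x g q)) =
      U1 p * (pd_t f p - (A p * pd_x (pd_x f) p + B p * pd_x f p))"
    using prol[folded q p, folded \<tau>_def \<xi>_def] A' B' w U1[folded w_def] U0[folded w_def] by algebra
  then have "pd_t g q - (A' q * pd_x (pd_x g) q + B' q * pd_x g q) =
      U1 p / \<tau> * (pd_t f p - (A p * pd_x (pd_x f) p + B p * pd_x f p))"
    using nz by (simp add: field_simps)
  then show ?thesis
    by (rule eq_iff_of_diff) (use nz in simp)
qed

text \<open>Membership in the equations can be tested on each pair of the prolongation separately. A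
  pair involves \<open>f\<close> and \<open>g\<close> only near one point, so the parameters may
  vary from box to box.\<close>

lemma connects_if_locally_affine:
  assumes \<Omega>: "\<Omega> \<subseteq> over D" "\<Phi> ` \<Omega> \<subseteq> over D'"
    and aff: "\<And>t x u. (t, x, u) \<in> \<Omega> \<Longrightarrow> \<exists>I J K T X U1 U0. open_interval I \<and> open_interval J \<and> open_interval K \<and>
      t \<in> I \<and> x \<in> J \<and> u \<in> K \<and> admissible_params A B I J T X U1 U0 \<and>
      (\<forall>p \<in> I \<times> J \<times> K. \<Phi> p = affine_map T X U1 U0 p) \<and> coeffs_related A B A' B' I J T X U1"
  shows "connects \<Omega> \<Phi> (kolmogorov_eq D A B) (kolmogorov_eq D' A' B')"
proof -
  have iff: "j \<in> kolmogorov_eq D A B \<longleftrightarrow> j' \<in> kolmogorov_eq D' A' B'"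
    if jj': "(j, j') \<in> prolongation \<Omega> \<Phi>" for j j'
  proof -
    obtain f g V W p q where j: "j = jet2 f p" "j' = jet2 g q"
      and f: "open V" "smooth_on V f" and g: "open W" "smooth_on W g"
      and im: "lift_pt f ` V \<subseteq> \<Omega>" "\<Phi> ` lift_pt f ` V = lift_pt g ` W"
      and pq: "p \<in> V" "q \<in> W" "\<Phi> (lift_pt f p) = lift_pt g q"
      using jj' unfolding prolongation_def by blast
    obtain t x where p: "p = (t, x)" by (cases p)
    have P: "(t, x, f p) \<in> \<Omega>"
      using im(1) pq(1) by (auto simp: lift_pt_def p)
    obtain I J K T X U1 U0 where box: "open_interval I" "open_interval J" "open_interval K"
      "t \<in> I" "x \<in> J" "f p \<in> K" and adm: "admissible_params A B I J T X U1 U0"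
      and \<Phi>: "\<forall>p \<in> I \<times> J \<times> K. \<Phi> p = affine_map T X U1 U0 p" and rel: "coeffs_related A B A' B' I J T X U1"
      using aff[OF P] by (elim exE conjE) (rule that)
    define N where "N = (V \<inter> f -` K) \<inter> (I \<times> J)"
    have "open K"
      using box by (simp add: open_interval_def)
    then have N: "open N"
      unfolding N_def using smooth_on_imp_continuous_on[OF f(2)] f(1) open_interval_Times[OF box(1,2)]
      by (intro open_Int continuous_open_preimage)
    have N': "p \<in> N" "N \<subseteq> I \<times> J" "N \<subseteq> V"
      using pq(1) box by (auto simp: N_def p)
    have graph: "\<forall>p\<in>N. fst p \<in> I \<and> (T (fst p), X p) \<in> W \<and> g (T (fst p), X p) = U1 p * f p + U0 p"
    proof
      fix p assume "p \<in> N"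
      then obtain s y where sy: "p = (s, y)" "(s, y) \<in> V" "(s, y, f (s, y)) \<in> I \<times> J \<times> K"
        by (cases p) (auto simp: N_def)
      have "\<Phi> (lift_pt f (s, y)) = (T s, X (s, y), U1 (s, y) * f (s, y) + U0 (s, y))"
        using \<Phi>[rule_format, OF sy(3)] by (simp add: lift_pt_def affine_map_def)
      from graph_image_in_domain[OF im(2) sy(2) this] graph_image_value[OF im(2) sy(2) this]
      show "fst p \<in> I \<and> (T (fst p), X p) \<in> W \<and> g (T (fst p), X p) = U1 p * f p + U0 p"
        using sy(3) by (simp add: sy(1))
    qed
    have "lift_pt g q = (T t, X p, U1 p * f p + U0 p)"
      unfolding pq(3)[symmetric] using box \<Phi>[rule_format, of "(t, x, f p)"]
      by (simp add: lift_pt_def affine_map_def p)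
    then have q: "q = (T (fst p), X p)"
      by (cases q) (simp add: lift_pt_def p)
    note equation_preserved[OF box(1,2) adm rel f g N N' graph,
        folded q]
    moreover have "p \<in> D"
      using P \<Omega>(1) by (auto simp: over_def p)
    moreover have "lift_pt g q \<in> over D'"
      using pq(1,3) im(1) \<Omega>(2) by (metis image_subset_iff)
    then have "q \<in> D'"
      by (simp add: over_def lift_pt_def)
    ultimately show ?thesis
      unfolding j by (simp add: jet2_def kolmogorov_eq_def)
  qed
  show ?thesis
    unfolding connects_def
  proof (intro equalityI subsetI)
    fix j' assume "j' \<in> prolongation \<Omega> \<Phi> `` kolmogorov_eq D A B"
    then obtain j where j: "(j, j') \<in> prolongation \<Omega> \<Phi>" "j \<in> kolmogorov_eq D A B"
      by (elim ImageE)
    then show "j' \<in> kolmogorov_eq D' A' B' \<inter> Range (prolongation \<Omega> \<Phi>)"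
      using iff[OF j(1)] by (intro IntI RangeI[OF j(1)]) simp
  next
    fix j' assume j': "j' \<in> kolmogorov_eq D' A' B' \<inter> Range (prolongation \<Omega> \<Phi>)"
    then obtain j where j: "(j, j') \<in> prolongation \<Omega> \<Phi>"
      by (elim IntE RangeE)
    have "j \<in> kolmogorov_eq D A B"
      using j' iff[OF j] by simp
    with j show "j' \<in> prolongation \<Omega> \<Phi> `` kolmogorov_eq D A B"
      by (rule ImageI)
  qed
qed

section \<open>Realization of arbitrary admissible parameters\<close>

lemma inj_on_open_interval:
  fixes f :: "real \<Rightarrow> real"
  assumes "open_interval I" "\<And>t. t \<in> I \<Longrightarrow> (f has_real_derivative f' t) (at t)"
    and "\<And>t. t \<in> I \<Longrightarrow> f' t \<noteq> 0"
  shows "inj_on f I"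
proof -
  have "f a \<noteq> f b" if ab: "a \<in> I" "b \<in> I" "a < b" for a b
  proof
    assume eq: "f a = f b"
    have I: "z \<in> I" if "a \<le> z" "z \<le> b" for z
      using assms(1) ab that unfolding open_interval_def is_interval_1 by blast
    have "\<exists>z. a < z \<and> z < b \<and> f b - f a = (b - a) * f' z"
      using ab(3) by (rule MVT2) (intro assms(2) I)
    then obtain z where "a < z" "z < b" "f b - f a = (b - a) * f' z"
      by blast
    with eq assms(3)[OF I[of z]] show False
      by simp
  qed
  then show ?thesis
    by (rule linorder_inj_onI')
qed

text \<open>T is injective on \<open>I\<close> and each \<open>X (t, _)\<close> on \<open>J\<close>,
  so the base map is injective on all of \<open>I \<times> J\<close>. The formulas of the theorem
  define the target coefficients at source points, and the inverse base map carries them to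
  \<open>H\<close>.\<close>

lemma affine_map_connects:
  fixes X U1 U0 :: "real \<times> real \<Rightarrow> real"
  assumes AB: "kolmogorov_class D A B" and IJK: "open_interval I" "open_interval J" "open_interval K"
    and IJ: "I \<times> J \<subseteq> D" and adm: "admissible_params A B I J T X U1 U0"
  defines "H \<equiv> (\<lambda>(t, x). (T t, X (t, x))) ` (I \<times> J)" and "\<Omega> \<equiv> I \<times> J \<times> K"
  shows "point_transformation \<Omega> (affine_map T X U1 U0)"
    and "\<exists>A' B'. kolmogorov_class H A' B' \<and>
      connects \<Omega> (affine_map T X U1 U0) (kolmogorov_eq D A B) (kolmogorov_eq H A' B')"
proof -
  note adm' = admissible_paramsD[OF adm]
  have op: "open I" "open (I \<times> J)" "open \<Omega>"
    using IJK by (auto simp: open_interval_def \<Omega>_def intro!: open_Times)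
  \<comment> \<open>T as a function of (t, x), as the results on inverse functions in the plane
    require.\<close>
  define a where "a p = T (fst p)" for p :: "real \<times> real"
  let ?h = "\<lambda>p. (a p, X p)"
  have a: "smooth_on (I \<times> J) a"
    unfolding a_def[abs_def]
    by (rule smooth_on_compose[OF op(2,1) _ adm'(1)]) (use op in \<open>auto intro: smooth_on_intros\<close>)
  have h: "?h = (\<lambda>(t, x). (T t, X (t, x)))"
    by (auto simp: a_def fun_eq_iff)
  have DT: "(T has_real_derivative deriv T t) (at t)" if "t \<in> I" for t
    using smooth_on_DERIV[OF adm'(1) that] .
  obtain x0 where x0: "x0 \<in> J"
    using IJK(2) by (auto simp: open_interval_def)
  have inj_T: "inj_on T I"
    by (rule inj_on_open_interval[OF IJK(1) DT adm'(5)[OF _ x0]])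
  have inj_X: "inj_on (\<lambda>x. X (t, x)) J" if "t \<in> I" for t
    using that by (intro inj_on_open_interval[OF IJK(2) DERIV_pd_x[OF adm'(2) op(2)] adm'(6)]) auto
  have inj: "inj_on ?h (I \<times> J)"
  proof (rule inj_onI)
    fix p p' assume pp': "p \<in> I \<times> J" "p' \<in> I \<times> J" "?h p = ?h p'"
    then have "fst p = fst p'"
      using inj_T by (auto simp: a_def dest: inj_onD)
    moreover from this have "snd p = snd p'"
      using pp' inj_onD[OF inj_X[of "fst p"], of "snd p" "snd p'"] by (cases p; cases p') auto
    ultimately show "p = p'"
      by (rule prod_eqI)
  qed
  have jac: "jac a X p \<noteq> 0" if p: "p \<in> I \<times> J" for p
  proof -
    obtain t x where tx: "p = (t, x)" "t \<in> I" "x \<in> J"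
      using p by auto
    have "pd_t a p = deriv T t" "pd_x a p = 0"
      by (simp_all add: tx(1) pd_t_def pd_x_def a_def)
    then show ?thesis
      using adm'(5,6)[OF tx(2,3)] by (simp add: jac_def tx(1))
  qed
  let ?k = "inv_into (I \<times> J) ?h"
  have H: "H = ?h ` (I \<times> J)"
    unfolding H_def h ..
  have opH: "open H" and k: "smooth_on H ?k"
    unfolding H by (rule smooth_inverse_plane[OF op(2) a adm'(2) inj jac]; assumption)+
  have kIJ: "?k q \<in> I \<times> J" "?h (?k q) = q" if "q \<in> H" for q
    using that unfolding H by (rule inv_into_into, rule f_inv_into_f)
  have kh: "?k (?h p) = p" if "p \<in> I \<times> J" for p
    using inj that by (rule inv_into_f_f)
  have smooth_k: "smooth_on H (\<lambda>q. F (?k q))" if "smooth_on (I \<times> J) F" for F :: "real \<times> real \<Rightarrow> real"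
    by (rule smooth_on_compose[OF opH op(2) _ that k]) (use kIJ in blast)

  \<comment> \<open>The cylinder over \<open>H\<close>, on which the inverse \<open>\<Psi>\<close>
    exists for all values of u and not only for those in the image of
    \<open>\<Omega>\<close>.\<close>
  define Y where "Y = {Q :: real \<times> real \<times> real. (fst Q, fst (snd Q)) \<in> H}"
  have "Y = (\<lambda>Q. (fst Q, fst (snd Q))) -` H"
    by (auto simp: Y_def)
  then have Y: "open Y"
    using opH by (auto intro!: open_vimage continuous_intros)
  define \<Psi> where "\<Psi> Q = (fst (?k (fst Q, fst (snd Q))), snd (?k (fst Q, fst (snd Q))),
    (snd (snd Q) - U0 (?k (fst Q, fst (snd Q)))) / U1 (?k (fst Q, fst (snd Q))))" for Q
  have pr: "smooth_on Y (\<lambda>Q. (fst Q, fst (snd Q)))"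
    using Y by (intro smooth_on_intros)
  have smooth_Y: "smooth_on Y (\<lambda>Q. F (?k (fst Q, fst (snd Q))))" if "smooth_on (I \<times> J) F" for F :: "real \<times> real \<Rightarrow> real"
    by (rule smooth_on_compose[OF Y opH _ smooth_k[OF that] pr]) (auto simp: Y_def)
  have \<Psi>: "smooth_on Y \<Psi>"
    unfolding \<Psi>_def[abs_def]
    by (intro smooth_on_Pair smooth_on_divide smooth_on_diff smooth_Y Y op adm'
        smooth_on_linear[OF op(2)] bounded_linear_fst bounded_linear_snd
        smooth_on_bounded_linear[OF bounded_linear_snd Y] smooth_on_linear[OF Y])
      (auto simp: Y_def intro!: kIJ)
  have \<Psi>\<Phi>: "affine_map T X U1 U0 P \<in> Y" "\<Psi> (affine_map T X U1 U0 P) = P" if "P \<in> \<Omega>" for P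
  proof -
    obtain t x u where P: "P = (t, x, u)" "t \<in> I" "x \<in> J" "u \<in> K"
      using \<open>P \<in> \<Omega>\<close> by (auto simp: \<Omega>_def)
    have tx: "(t, x) \<in> I \<times> J"
      using P by simp
    have "(T t, X (t, x)) = ?h (t, x)"
      by (simp add: a_def)
    then have "(T t, X (t, x)) \<in> H" "?k (T t, X (t, x)) = (t, x)"
      using kh[OF tx] tx unfolding H by simp_all
    then show "affine_map T X U1 U0 P \<in> Y" "\<Psi> (affine_map T X U1 U0 P) = P"
      using adm'(7)[OF tx] by (simp_all add: P(1) affine_map_def Y_def \<Psi>_def)
  qed
  \<comment> \<open>Describing the image as a preimage under the continuous \<open>\<Psi>\<close>
    shows that it is open.\<close>
  have "affine_map T X U1 U0 ` \<Omega> = Y \<inter> \<Psi> -` \<Omega>"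
  proof (intro equalityI subsetI)
    fix Q assume "Q \<in> affine_map T X U1 U0 ` \<Omega>"
    then show "Q \<in> Y \<inter> \<Psi> -` \<Omega>"
      using \<Psi>\<Phi> by auto
  next
    fix Q assume Q: "Q \<in> Y \<inter> \<Psi> -` \<Omega>"
    obtain q1 q2 q3 where q: "Q = (q1, q2, q3)" by (cases Q)
    have qH: "(q1, q2) \<in> H"
      using Q by (simp add: Y_def q)
    obtain t x where tx: "?k (q1, q2) = (t, x)" by (cases "?k (q1, q2)")
    have txIJ: "(t, x) \<in> I \<times> J" and h_tx: "?h (t, x) = (q1, q2)"
      using kIJ[OF qH] unfolding tx .
    have "\<Psi> Q = (t, x, (q3 - U0 (t, x)) / U1 (t, x))"
      by (simp only: \<Psi>_def q fst_conv snd_conv tx)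
    then have "affine_map T X U1 U0 (\<Psi> Q) = Q"
      using adm'(7)[OF txIJ] h_tx by (simp add: affine_map_def q a_def)
    then show "Q \<in> affine_map T X U1 U0 ` \<Omega>"
      using Q by (metis IntE image_eqI vimageE)
  qed
  moreover have "open (Y \<inter> \<Psi> -` \<Omega>)"
    using smooth_on_imp_continuous_on[OF \<Psi>] Y op(3) by (rule continuous_open_preimage)
  ultimately have im: "affine_map T X U1 U0 ` \<Omega> \<subseteq> Y" "open (affine_map T X U1 U0 ` \<Omega>)"
    by simp_all
  have smooth_\<Omega>: "smooth_on \<Omega> (\<lambda>P. F (fst P, fst (snd P)))" if "smooth_on (I \<times> J) F" for F :: "real \<times> real \<Rightarrow> real"
    by (rule smooth_on_compose[OF op(3,2) _ that]) (use op in \<open>auto simp: \<Omega>_def intro!: smooth_on_intros\<close>)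
  have "affine_map T X U1 U0 = (\<lambda>P. (a (fst P, fst (snd P)), X (fst P, fst (snd P)),
      U1 (fst P, fst (snd P)) * snd (snd P) + U0 (fst P, fst (snd P))))"
    by (auto simp: affine_map_def a_def fun_eq_iff)
  moreover have "smooth_on \<Omega> (\<lambda>P. (a (fst P, fst (snd P)), X (fst P, fst (snd P)),
      U1 (fst P, fst (snd P)) * snd (snd P) + U0 (fst P, fst (snd P))))"
    by (intro smooth_on_Pair smooth_on_add smooth_on_mult smooth_\<Omega> a adm' op
        smooth_on_bounded_linear[OF bounded_linear_snd] smooth_on_linear bounded_linear_snd)
  ultimately have "smooth_on \<Omega> (affine_map T X U1 U0)"
    by simp
  then show "point_transformation \<Omega> (affine_map T X U1 U0)"
    unfolding point_transformation_def
    using op(3) im(2) smooth_on_subset[OF \<Psi> im(1)] \<Psi>\<Phi>(2) by (intro conjI exI[of _ \<Psi>] ballI)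

  \<comment> \<open>The right-hand sides of the coefficient relations, as functions of the source
    point.\<close>
  define A0 where "A0 p = (pd_x X p)\<^sup>2 / deriv T (fst p) * A p" for p
  define B0 where "B0 p = pd_x X p / deriv T (fst p) * (B p - 2 * (pd_x U1 p / U1 p) * A p)
    - (pd_t X p - pd_x (pd_x X) p * A p) / deriv T (fst p)" for p
  have AB': "smooth_on (I \<times> J) A" "smooth_on (I \<times> J) B" "\<And>p. p \<in> I \<times> J \<Longrightarrow> A p \<noteq> 0"
    using AB IJ by (auto simp: kolmogorov_class_def intro: smooth_on_subset)
  have DT': "smooth_on (I \<times> J) (\<lambda>p. deriv T (fst p))"
    by (rule smooth_on_compose[OF op(2,1) _ smooth_on_deriv[OF op(1) adm'(1)]])
      (use op in \<open>auto intro: smooth_on_intros\<close>)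
  have nz: "deriv T (fst p) \<noteq> 0" "pd_x X p \<noteq> 0" if "p \<in> I \<times> J" for p
    using that adm'(5,6) by auto
  have smooth: "smooth_on (I \<times> J) A0" "smooth_on (I \<times> J) B0"
    unfolding A0_def[abs_def] B0_def[abs_def] power2_eq_square
    by (intro smooth_on_mult smooth_on_divide smooth_on_diff smooth_on_const smooth_on_pd_t smooth_on_pd_x
        DT' op adm' AB' nz; assumption)+
  have "kolmogorov_class H (\<lambda>q. A0 (?k q)) (\<lambda>q. B0 (?k q))"
    unfolding kolmogorov_class_def
  proof (intro conjI opH smooth_k smooth ballI)
    fix q assume "q \<in> H"
    from kIJ(1)[OF this] show "A0 (?k q) \<noteq> 0"
      using nz AB'(3) by (simp add: A0_def)
  qed
  moreover have "connects \<Omega> (affine_map T X U1 U0) (kolmogorov_eq D A B)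
      (kolmogorov_eq H (\<lambda>q. A0 (?k q)) (\<lambda>q. B0 (?k q)))"
  proof (rule connects_if_locally_affine)
    show "\<Omega> \<subseteq> over D"
      using IJ by (auto simp: \<Omega>_def over_def)
    show "affine_map T X U1 U0 ` \<Omega> \<subseteq> over H"
    proof -
      have "Y = over H"
        by (auto simp: Y_def over_def)
      with im(1) show ?thesis by simp
    qed
    have "?k (T t, X (t, x)) = (t, x)" if "t \<in> I" "x \<in> J" for t x
      using kh[of "(t, x)"] that by (simp add: a_def)
    then have "coeffs_related A B (\<lambda>q. A0 (?k q)) (\<lambda>q. B0 (?k q)) I J T X U1"
      by (simp add: A0_def B0_def)
    then show "\<exists>I J K T' X' U1' U0'. open_interval I \<and> open_interval J \<and> open_interval K \<and>
        t \<in> I \<and> x \<in> J \<and> u \<in> K \<and> admissible_params A B I J T' X' U1' U0' \<and>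
        (\<forall>p \<in> I \<times> J \<times> K. affine_map T X U1 U0 p = affine_map T' X' U1' U0' p) \<and>
        coeffs_related A B (\<lambda>q. A0 (?k q)) (\<lambda>q. B0 (?k q)) I J T' X' U1'"
      if "(t, x, u) \<in> \<Omega>" for t x u
      using that IJK adm
      by (intro exI[of _ I] exI[of _ J] exI[of _ K] exI[of _ T] exI[of _ X] exI[of _ U1] exI[of _ U0])
        (simp add: \<Omega>_def)
  qed
  ultimately show "\<exists>A' B'. kolmogorov_class H A' B' \<and>
      connects \<Omega> (affine_map T X U1 U0) (kolmogorov_eq D A B) (kolmogorov_eq H A' B')"
    by blast
qed

text \<open>The affine form is required on boxes because slices of \<open>\<Omega>\<close> may be
  disconnected, and then a single T depending on t alone need not exist on all of
  \<open>\<Omega>\<close>. The second conjunct expresses that the parameters are arbitrary: every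
  admissible choice occurs for some target equation.\<close>

theorem proposition23:
  fixes A B :: "real \<times> real \<Rightarrow> real" and D :: "(real \<times> real) set"
  assumes "kolmogorov_class D A B"
  shows
    "(\<forall>A' B' D' \<Phi> \<Omega>.
        kolmogorov_class D' A' B' \<and> point_transformation \<Omega> \<Phi> \<and>
        \<Omega> \<subseteq> over D \<and> \<Phi> ` \<Omega> \<subseteq> over D' \<longrightarrow>
        (connects \<Omega> \<Phi> (kolmogorov_eq D A B) (kolmogorov_eq D' A' B') \<longleftrightarrow>
         (\<forall>I J K. open_interval I \<and> open_interval J \<and> open_interval K \<and> I \<times> J \<times> K \<subseteq> \<Omega> \<longrightarrow>
           (\<exists>T X U1 U0.
              admissible_params A B I J T X U1 U0 \<and>
              (\<forall>p \<in> I \<times> J \<times> K. \<Phi> p = affine_map T X U1 U0 p) \<and>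
              (\<forall>t\<in>I. \<forall>x\<in>J.
                 A' (T t, X (t, x)) = (pd_x X (t, x))\<^sup>2 / deriv T t * A (t, x) \<and>
                 B' (T t, X (t, x)) =
                   pd_x X (t, x) / deriv T t * (B (t, x) - 2 * (pd_x U1 (t, x) / U1 (t, x)) * A (t, x))
                   - (pd_t X (t, x) - pd_x (pd_x X) (t, x) * A (t, x)) / deriv T t)))))
     \<and>
     (\<forall>I J K T X U1 U0.
        open_interval I \<and> open_interval J \<and> open_interval K \<and> I \<times> J \<subseteq> D \<and>
        admissible_params A B I J T X U1 U0 \<longrightarrow>
        point_transformation (I \<times> J \<times> K) (affine_map T X U1 U0) \<and>
        (\<exists>A' B'.
           kolmogorov_class ((\<lambda>(t, x). (T t, X (t, x))) ` (I \<times> J)) A' B' \<and>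
           connects (I \<times> J \<times> K) (affine_map T X U1 U0) (kolmogorov_eq D A B)
             (kolmogorov_eq ((\<lambda>(t, x). (T t, X (t, x))) ` (I \<times> J)) A' B')))"
proof (intro conjI allI impI, goal_cases)
  case (1 A' B' D' \<Phi> \<Omega>)
  then have target: "kolmogorov_class D' A' B'" and pt: "point_transformation \<Omega> \<Phi>"
    and over: "\<Omega> \<subseteq> over D" "\<Phi> ` \<Omega> \<subseteq> over D'"
    by simp_all
  show ?case (is "?connects \<longleftrightarrow> ?affine")
  proof
    assume ?connects
    with assms target pt over interpret connected_equations A B A' B' D D' \<Phi> \<Omega>
      by unfold_locales
    show ?affine
      by (intro allI impI, elim conjE) (rule locally_affine)
  next
    assume affine: ?affine
    show ?connects
    proof (rule connects_if_locally_affine[OF over])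
      fix t x u assume "(t, x, u) \<in> \<Omega>"
      moreover have "open \<Omega>"
        using pt by (simp add: point_transformation_def)
      ultimately obtain I J K where box: "open_interval I" "open_interval J" "open_interval K"
        "t \<in> I" "x \<in> J" "u \<in> K" "I \<times> J \<times> K \<subseteq> \<Omega>"
        using box_neighbourhood by blast
      with affine[rule_format, of I J K]
      show "\<exists>I J K T X U1 U0. open_interval I \<and> open_interval J \<and> open_interval K \<and>
          t \<in> I \<and> x \<in> J \<and> u \<in> K \<and> admissible_params A B I J T X U1 U0 \<and>
          (\<forall>p \<in> I \<times> J \<times> K. \<Phi> p = affine_map T X U1 U0 p) \<and> coeffs_related A B A' B' I J T X U1"
        by blast
    qed
  qed
next
  case (2 I J K T X U1 U0)
  then show ?case
    using affine_map_connects(1)[OF assms] by blast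
next
  case (3 I J K T X U1 U0)
  then show ?case
    using affine_map_connects(2)[OF assms] by blast
qed

end
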